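(* Let $G$ be a word hyperbolic group and $A$ a finitely generated abelian group on which $G$ acts with finite image in $\mathrm{Aut}(A)$. Then every class in $H^2(G;A)$ can be represented by a bounded $2$-cocycle, i.e. a cocycle $\sigma$ with $\sigma(G,G)$ finite.
   Context: The action is written $a\mapsto a^g$. A $2$-cocycle is a function $\sigma:G\times G\to A$ with $\sigma(g,h_1h_2)=\sigma(g,h_1)^{h_2}+\sigma(gh_1,h_2)-\sigma(h_1,h_2)$; coboundaries are $(g,h)\mapsto f(g)^h+f(h)-f(gh)$ for $f:G\to A$; $H^2(G;A)$ is cocycles modulo coboundaries. *)

theory Defs
  imports "HOL-Algebra.Algebra"
begin

definition word_length :: "('g, 'b) monoid_scheme \<Rightarrow> 'g set \<Rightarrow> 'g \<Rightarrow> nat" where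
  "word_length G S g =
     (LEAST n. \<exists>ws. length ws = n \<and> set ws \<subseteq> S \<union> (\<lambda>s. inv\<^bsub>G\<^esub> s) ` S
                  \<and> foldr (\<lambda>x y. x \<otimes>\<^bsub>G\<^esub> y) ws \<one>\<^bsub>G\<^esub> = g)"

definition word_dist :: "('g, 'b) monoid_scheme \<Rightarrow> 'g set \<Rightarrow> 'g \<Rightarrow> 'g \<Rightarrow> real" where
  "word_dist G S x y = real (word_length G S (inv\<^bsub>G\<^esub> x \<otimes>\<^bsub>G\<^esub> y))"

definition gromov_product :: "('g, 'b) monoid_scheme \<Rightarrow> 'g set \<Rightarrow> 'g \<Rightarrow> 'g \<Rightarrow> 'g \<Rightarrow> real" where
  "gromov_product G S w x y =
     (word_dist G S w x + word_dist G S w y - word_dist G S x y) / 2"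

definition hyperbolic_group :: "('g, 'b) monoid_scheme \<Rightarrow> bool" where
  "hyperbolic_group G \<longleftrightarrow> group G \<and>
     (\<exists>S \<delta>. finite S \<and> S \<subseteq> carrier G \<and> generate G S = carrier G \<and>
        (\<forall>w\<in>carrier G. \<forall>x\<in>carrier G. \<forall>y\<in>carrier G. \<forall>z\<in>carrier G.
           gromov_product G S w x y \<ge>
             min (gromov_product G S w x z) (gromov_product G S w y z) - \<delta>))"

definition fg_abelian_group :: "('a, 'c) monoid_scheme \<Rightarrow> bool" where
  "fg_abelian_group A \<longleftrightarrow> comm_group A \<and>
     (\<exists>T. finite T \<and> T \<subseteq> carrier A \<and> generate A T = carrier A)"

definition right_action_by_auts ::
  "('g, 'b) monoid_scheme \<Rightarrow> ('a, 'c) monoid_scheme \<Rightarrow> ('g \<Rightarrow> 'a \<Rightarrow> 'a) \<Rightarrow> bool" where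
  "right_action_by_auts G A act \<longleftrightarrow>
     (\<forall>g\<in>carrier G. act g \<in> iso A A) \<and>
     (\<forall>a\<in>carrier A. act \<one>\<^bsub>G\<^esub> a = a) \<and>
     (\<forall>g\<in>carrier G. \<forall>h\<in>carrier G. \<forall>a\<in>carrier A. act (g \<otimes>\<^bsub>G\<^esub> h) a = act h (act g a))"

definition action_image ::
  "('g, 'b) monoid_scheme \<Rightarrow> ('a, 'c) monoid_scheme \<Rightarrow> ('g \<Rightarrow> 'a \<Rightarrow> 'a) \<Rightarrow> ('a \<Rightarrow> 'a) set" where
  "action_image G A act = (\<lambda>g. restrict (act g) (carrier A)) ` carrier G"

definition cocycle2 ::
  "('g, 'b) monoid_scheme \<Rightarrow> ('a, 'c) monoid_scheme \<Rightarrow> ('g \<Rightarrow> 'a \<Rightarrow> 'a) \<Rightarrow> ('g \<Rightarrow> 'g \<Rightarrow> 'a) \<Rightarrow> bool" where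
  "cocycle2 G A act \<sigma> \<longleftrightarrow>
     (\<forall>g\<in>carrier G. \<forall>h\<in>carrier G. \<sigma> g h \<in> carrier A) \<and>
     (\<forall>g\<in>carrier G. \<forall>h1\<in>carrier G. \<forall>h2\<in>carrier G.
        \<sigma> g (h1 \<otimes>\<^bsub>G\<^esub> h2) =
          act h2 (\<sigma> g h1) \<otimes>\<^bsub>A\<^esub> \<sigma> (g \<otimes>\<^bsub>G\<^esub> h1) h2 \<otimes>\<^bsub>A\<^esub> inv\<^bsub>A\<^esub> (\<sigma> h1 h2))"

definition coboundary2 ::
  "('g, 'b) monoid_scheme \<Rightarrow> ('a, 'c) monoid_scheme \<Rightarrow> ('g \<Rightarrow> 'a \<Rightarrow> 'a) \<Rightarrow> ('g \<Rightarrow> 'a) \<Rightarrow> 'g \<Rightarrow> 'g \<Rightarrow> 'a" where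
  "coboundary2 G A act f g h =
     act h (f g) \<otimes>\<^bsub>A\<^esub> f h \<otimes>\<^bsub>A\<^esub> inv\<^bsub>A\<^esub> (f (g \<otimes>\<^bsub>G\<^esub> h))"

definition cohomologous2 ::
  "('g, 'b) monoid_scheme \<Rightarrow> ('a, 'c) monoid_scheme \<Rightarrow> ('g \<Rightarrow> 'a \<Rightarrow> 'a)
     \<Rightarrow> ('g \<Rightarrow> 'g \<Rightarrow> 'a) \<Rightarrow> ('g \<Rightarrow> 'g \<Rightarrow> 'a) \<Rightarrow> bool" where
  "cohomologous2 G A act \<sigma> \<tau> \<longleftrightarrow>
     (\<exists>f. f \<in> carrier G \<rightarrow> carrier A \<and>
        (\<forall>g\<in>carrier G. \<forall>h\<in>carrier G. \<sigma> g h = \<tau> g h \<otimes>\<^bsub>A\<^esub> coboundary2 G A act f g h))"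

end

theory Submission
  imports Defs
begin

text \<open>
  On a hyperbolic Cayley graph, let \<open>b\<close> be an integral edge weight whose loops of bounded length have bounded
  weight. A long loop contains a short non-geodesic segment, so loop weights are at most \<open>K\<close> times the length.
  Hence the maximum \<open>P(x,y)\<close> of \<open>weight - (K + 1) length\<close> over all walks from \<open>x\<close> to \<open>y\<close> exists, and optimal walks are
  quasigeodesics. By the Morse lemma \<open>P(x,y)\<close> is additive, up to a bounded error, at points \<open>p\<close> near a geodesic,
  and so \<open>P(x,y) - P(y,x)\<close> has bounded coboundary: split each side of a triangle at the centre.

  For an additive map \<open>\<psi> : A \<rightarrow> \<int>\<close> the weight \<open>\<psi>(c(1,x,y))\<close>, where \<open>c\<close> is the homogeneous form of the cocycle, has this
  property uniformly over the finitely many translates of \<open>\<psi>\<close>. Up to torsion, finitely many \<open>\<psi>\<close> determine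
  \<open>A\<close>, and averaging over the finite image of \<open>G\<close> assembles the resulting real potentials, rounded to integers,
  into a function \<open>f : G \<rightarrow> A\<close> whose coboundary makes the cocycle bounded.
\<close>

section \<open>Geodesic hyperbolic graphs\<close>

text \<open>The weight \<psi>(c(1,x,y)) is not invariant under left translation: the base vertex 1
  moves, and the functional is twisted by the action. The cocycle identity confines the first defect
  to a difference h(y) - h(x), which telescopes along walks and vanishes on loops; the second is
  absorbed by treating all translates of \<psi> at once. So loops may be moved to the identity,
  where a finite ball bounds the weight of the short ones, even if edge weights are unbounded.

  The length penalty controls optimal walks but spoils the potential: P(x,y) + P(y,x) is at most -2
  times the distance, so P alone does not have a bounded coboundary on an unbounded graph.
  Antisymmetrising cancels the penalty and doubles the potential.\<close>

locale hyperbolic_graph =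
  fixes V :: "'p set" and D :: "'p \<Rightarrow> 'p \<Rightarrow> nat" and \<delta> :: nat
  assumes D_self: "x \<in> V \<Longrightarrow> D x x = 0"
    and D_eq_0: "x \<in> V \<Longrightarrow> y \<in> V \<Longrightarrow> D x y = 0 \<Longrightarrow> x = y"
    and D_sym: "x \<in> V \<Longrightarrow> y \<in> V \<Longrightarrow> D x y = D y x"
    and D_triangle: "x \<in> V \<Longrightarrow> y \<in> V \<Longrightarrow> z \<in> V \<Longrightarrow> D x z \<le> D x y + D y z"
    and D_Suc: "x \<in> V \<Longrightarrow> y \<in> V \<Longrightarrow> D x y = Suc n \<Longrightarrow> \<exists>z\<in>V. D x z = n \<and> D z y = 1"
    and four_point: "x \<in> V \<Longrightarrow> y \<in> V \<Longrightarrow> z \<in> V \<Longrightarrow> t \<in> V \<Longrightarrow>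
          D x y + D z t \<le> max (D x z + D y t) (D x t + D y z) + \<delta>"
begin

section \<open>Walks, their lengths and their weights\<close>

definition walk :: "nat \<Rightarrow> (nat \<Rightarrow> 'p) \<Rightarrow> bool" where
  "walk n w \<longleftrightarrow> (\<forall>i\<le>n. w i \<in> V) \<and> (\<forall>i<n. D (w i) (w (Suc i)) \<le> 1)"

text \<open>Forgetting the intermediate vertices lets walks be concatenated and compared by length
  and weight alone. A step may also stay at a vertex \<open>x\<close>, since \<open>walk\<close>
  asks only for distance at most 1; it then contributes \<open>b x x\<close>.\<close>

definition weighted_walk :: "('p \<Rightarrow> 'p \<Rightarrow> int) \<Rightarrow> 'p \<Rightarrow> 'p \<Rightarrow> nat \<Rightarrow> int \<Rightarrow> bool" where
  "weighted_walk b x y n s \<longleftrightarrow>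
     (\<exists>w. walk n w \<and> w 0 = x \<and> w n = y \<and> s = (\<Sum>i<n. b (w i) (w (Suc i))))"

lemma walk_D_le: "walk n w \<Longrightarrow> i + m \<le> n \<Longrightarrow> D (w i) (w (i + m)) \<le> m"
proof (induction m)
  case 0
  then show ?case by (simp add: walk_def D_self)
next
  case (Suc m)
  then have "D (w i) (w (i + m)) \<le> m" "D (w (i + m)) (w (Suc (i + m))) \<le> 1"
    "w i \<in> V" "w (i + m) \<in> V" "w (Suc (i + m)) \<in> V"
    by (auto simp: walk_def)
  then show ?case using D_triangle[of "w i" "w (i + m)" "w (Suc (i + m))"] by simp
qed

lemma weighted_walk_segment:
  assumes "walk n w" "i + m \<le> n"
  shows "weighted_walk b (w i) (w (i + m)) m (\<Sum>k<m. b (w (i + k)) (w (i + Suc k)))"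
  unfolding weighted_walk_def
  by (rule exI[of _ "\<lambda>k. w (i + k)"]) (use assms in \<open>auto simp: walk_def\<close>)

lemma weighted_walk_split:
  assumes "walk n w" "i \<le> n" "(\<Sum>k<n. b (w k) (w (Suc k))) = s"
  obtains s1 s2 where "weighted_walk b (w 0) (w i) i s1" "weighted_walk b (w i) (w n) (n - i) s2"
    "s1 = (\<Sum>k<i. b (w k) (w (Suc k)))" "s = s1 + s2"
proof -
  have "(\<Sum>k<i+m. b (w k) (w (Suc k))) =
    (\<Sum>k<i. b (w k) (w (Suc k))) + (\<Sum>k<m. b (w (i + k)) (w (i + Suc k)))" for m
    by (induction m) auto
  from this[of "n - i"] have a: "s = (\<Sum>k<i. b (w k) (w (Suc k))) + (\<Sum>k<n-i. b (w (i + k)) (w (i + Suc k)))"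
    using assms(2,3) by simp
  show ?thesis
  proof (rule that[OF _ _ refl a])
    show "weighted_walk b (w 0) (w i) i (\<Sum>k<i. b (w k) (w (Suc k)))"
      using weighted_walk_segment[of n w 0 i b] assms by simp
    show "weighted_walk b (w i) (w n) (n - i) (\<Sum>k<n-i. b (w (i + k)) (w (i + Suc k)))"
      using weighted_walk_segment[of n w i "n - i" b] assms by simp
  qed
qed

lemma weighted_walk_split3:
  assumes w: "walk n w" and im: "i + m \<le> n" and s: "(\<Sum>k<n. b (w k) (w (Suc k))) = s"
  obtains s1 s2 s3 where "weighted_walk b (w 0) (w i) i s1" "weighted_walk b (w i) (w (i + m)) m s2"
    "weighted_walk b (w (i + m)) (w n) (n - (i + m)) s3" "s = s1 + s2 + s3"
proof -
  obtain s12 s3 where 1: "weighted_walk b (w (i + m)) (w n) (n - (i + m)) s3"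
      "s12 = (\<Sum>k<i+m. b (w k) (w (Suc k)))" "s = s12 + s3"
    using weighted_walk_split[OF w im s] by metis
  have "walk (i + m) w" using w im by (auto simp: walk_def)
  then obtain s1 s2 where "weighted_walk b (w 0) (w i) i s1" "weighted_walk b (w i) (w (i + m)) m s2"
      "s12 = s1 + s2"
    using weighted_walk_split[OF _ _ 1(2)[symmetric], of i] by (metis add_diff_cancel_left' le_add1)
  with 1 that show ?thesis by metis
qed

lemma weighted_walk_in_V: "weighted_walk b x y n s \<Longrightarrow> x \<in> V \<and> y \<in> V"
  by (auto simp: weighted_walk_def walk_def)

lemma weighted_walk_D_le: "weighted_walk b x y n s \<Longrightarrow> D x y \<le> n"
  unfolding weighted_walk_def using walk_D_le[of n _ 0 n] by auto

lemma weighted_walk_Nil: "x \<in> V \<Longrightarrow> weighted_walk b x x 0 0"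
  by (auto simp: weighted_walk_def walk_def)

lemma weighted_walk_append:
  assumes "weighted_walk b x y n s" "weighted_walk b y z m t"
  shows "weighted_walk b x z (n + m) (s + t)"
proof -
  obtain u where u: "walk n u" "u 0 = x" "u n = y" "s = (\<Sum>i<n. b (u i) (u (Suc i)))"
    using assms(1) by (auto simp: weighted_walk_def)
  obtain v where v: "walk m v" "v 0 = y" "v m = z" "t = (\<Sum>i<m. b (v i) (v (Suc i)))"
    using assms(2) by (auto simp: weighted_walk_def)
  define w where "w = (\<lambda>i. if i \<le> n then u i else v (i - n))"
  have wv: "w (n + i) = v i" for i using u v by (auto simp: w_def)
  have wu: "i \<le> n \<Longrightarrow> w i = u i" for i by (auto simp: w_def)
  have "walk (n + m) w"
    unfolding walk_def
  proof (intro conjI allI impI)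
    fix i assume "i \<le> n + m"
    then show "w i \<in> V" using u v by (auto simp: w_def walk_def)
  next
    fix i assume i: "i < n + m"
    show "D (w i) (w (Suc i)) \<le> 1"
    proof (cases "i < n")
      case True
      then show ?thesis using u by (auto simp: w_def walk_def)
    next
      case False
      then show ?thesis using wv[of "i - n"] wv[of "Suc (i - n)"] v i by (auto simp: walk_def)
    qed
  qed
  moreover have "(\<Sum>i<n+m. b (w i) (w (Suc i))) = s + t"
  proof -
    have "(\<Sum>i<n+m. b (w i) (w (Suc i))) =
      (\<Sum>i<n. b (w i) (w (Suc i))) + (\<Sum>i<m. b (w (n + i)) (w (n + Suc i)))"
      by (induction m) auto
    also have "(\<Sum>i<n. b (w i) (w (Suc i))) = s" unfolding u by (rule sum.cong) (auto simp: wu)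
    also have "(\<Sum>i<m. b (w (n + i)) (w (n + Suc i))) = t" unfolding v wv ..
    finally show ?thesis .
  qed
  ultimately show ?thesis unfolding weighted_walk_def
    using u v wu[of 0] wv[of m] by (intro exI[of _ w]) auto
qed

lemma weighted_walk_edge:
  assumes "x \<in> V" "y \<in> V" "D x y \<le> 1"
  shows "weighted_walk b x y 1 (b x y)"
  unfolding weighted_walk_def
  by (rule exI[of _ "\<lambda>i. if i = 0 then x else y"]) (use assms in \<open>auto simp: walk_def\<close>)

lemma weighted_walk_transport:
  assumes T: "\<And>x. x \<in> V \<Longrightarrow> T x \<in> V" "\<And>x y. x \<in> V \<Longrightarrow> y \<in> V \<Longrightarrow> D (T x) (T y) = D x y"
    and h: "\<And>x y. x \<in> V \<Longrightarrow> y \<in> V \<Longrightarrow> b (T x) (T y) = b' x y + h y - h x"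
    and s: "weighted_walk b' x y n s"
  shows "weighted_walk b (T x) (T y) n (s + h y - h x)"
proof -
  obtain w where w: "walk n w" "w 0 = x" "w n = y" "s = (\<Sum>i<n. b' (w i) (w (Suc i)))"
    using s by (auto simp: weighted_walk_def)
  have "walk n (\<lambda>i. T (w i))" using w T by (auto simp: walk_def)
  moreover have "(\<Sum>i<n. b (T (w i)) (T (w (Suc i)))) = s + h y - h x"
  proof -
    have "(\<Sum>i<n. b (T (w i)) (T (w (Suc i)))) = (\<Sum>i<n. b' (w i) (w (Suc i)) + (h (w (Suc i)) - h (w i)))"
      by (rule sum.cong) (use w h in \<open>auto simp: walk_def\<close>)
    also have "\<dots> = s + (h (w n) - h (w 0))"
      using sum_lessThan_telescope[of "\<lambda>i. h (w i)" n] by (simp add: sum.distrib w(4))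
    finally show ?thesis using w by simp
  qed
  ultimately show ?thesis unfolding weighted_walk_def using w by (intro exI[of _ "\<lambda>i. T (w i)"]) auto
qed

section \<open>Geodesics, loops and centres of triangles\<close>

lemma geodesic_weighted_walk:
  assumes "x \<in> V" "y \<in> V"
  obtains s where "weighted_walk b x y (D x y) s"
proof -
  have "\<exists>s. weighted_walk b x y n s" if "D x y = n" "y \<in> V" for n y
    using that
  proof (induction n arbitrary: y)
    case 0
    then show ?case using D_eq_0[of x y] weighted_walk_Nil assms by blast
  next
    case (Suc n)
    obtain z where z: "z \<in> V" "D x z = n" "D z y = 1"
      using D_Suc assms Suc by blast
    obtain s where "weighted_walk b x z n s" using Suc z by blast
    from weighted_walk_append[OF this weighted_walk_edge[of z y]] z Suc
    show ?case by auto
  qed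
  then show ?thesis using assms that by blast
qed

lemma geodesic_walk:
  assumes "x \<in> V" "y \<in> V"
  obtains w where "walk (D x y) w" "w 0 = x" "w (D x y) = y"
  using geodesic_weighted_walk[OF assms, of "\<lambda>_ _. 0"] by (auto simp: weighted_walk_def)

text \<open>Consider a vertex of the loop farthest from its start. If all segments of length at most
  \<open>2 * k\<close> were geodesic, the vertices \<open>k\<close> steps before and after it would
  be \<open>2 * k\<close> apart but no farther from the start, and the four-point inequality would
  give \<open>k \<le> \<delta>\<close>.\<close>

lemma loop_shortcut:
  assumes w: "walk n w" "w 0 = w n" and k: "k = Suc \<delta>" "2 * k \<le> n"
  shows "\<exists>i m. i + m \<le> n \<and> m \<le> 2 * k \<and> D (w i) (w (i + m)) < m"
proof (rule ccontr)
  assume "\<not> ?thesis"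
  then have geo: "i + m \<le> n \<Longrightarrow> m \<le> 2 * k \<Longrightarrow> D (w i) (w (i + m)) = m" for i m
    using walk_D_le[OF w(1), of i m] by (meson le_neq_implies_less)
  have V: "i \<le> n \<Longrightarrow> w i \<in> V" for i using w by (auto simp: walk_def)
  have "finite ((\<lambda>i. D (w 0) (w i)) ` {..n})" "(\<lambda>i. D (w 0) (w i)) ` {..n} \<noteq> {}" by auto
  from Max_in[OF this] obtain i where i: "i \<le> n"
    and "D (w 0) (w i) = Max ((\<lambda>i. D (w 0) (w i)) ` {..n})" by fastforce
  then have mx: "j \<le> n \<Longrightarrow> D (w 0) (w j) \<le> D (w 0) (w i)" for j by simp
  \<comment> \<open>Being this far from the common endpoint of the loop, the farthest vertex has
    \<open>k\<close> steps left on either side.\<close>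
  have "2 * k \<le> D (w 0) (w i)" using mx[of "2 * k"] geo[of 0 "2 * k"] k by simp
  moreover have "D (w 0) (w i) \<le> i" using walk_D_le[OF w(1), of 0 i] i by simp
  moreover have "D (w 0) (w i) \<le> n - i"
    using walk_D_le[OF w(1), of i "n - i"] i D_sym[of "w i" "w n"] V w by simp
  ultimately have ik: "k \<le> i" "i + k \<le> n" using i by auto
  let ?u = "w (i - k)" and ?p = "w i" and ?v = "w (i + k)"
  have "D ?u ?p = k" "D ?p ?v = k" "D ?u ?v = 2 * k"
    using geo[of "i - k" k] geo[of i k] geo[of "i - k" "2 * k"] ik by (auto simp: mult_2)
  moreover have "D (w 0) ?u \<le> D (w 0) ?p" "D (w 0) ?v \<le> D (w 0) ?p" using mx ik by auto
  moreover have "D (w 0) ?p + D ?u ?v \<le> max (D (w 0) ?u + D ?p ?v) (D (w 0) ?v + D ?p ?u) + \<delta>"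
    using four_point V ik i by auto
  moreover have "D ?p ?u = D ?u ?p" using D_sym V ik i by auto
  ultimately show False using k by auto
qed

text \<open>The inequality for Gromov products at \<open>p\<close>, doubled and with all subtractions moved across.\<close>

lemma gromov_ultrametric:
  assumes "p \<in> V" "x \<in> V" "y \<in> V" "z \<in> V"
    and "D x z + t \<le> D p x + D p z + c" "D z y + t \<le> D p z + D p y + c"
  shows "D x y + t \<le> D p x + D p y + c + \<delta>"
  using four_point[of x y p z] assms(5,6) D_sym[of x p] D_sym[of y p] D_sym[of y z] D_sym[of x z] assms(1-4)
  by (auto simp: max_def split: if_splits)

text \<open>Repeated bisection: each halving costs one four-point inequality, that is, one \<delta>
  in the doubled Gromov product at \<open>p\<close>. After \<open>k\<close> halvings single steps
  remain, whose length accounts for the summand 1. So a walk that avoids a large ball and joins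
  points with small Gromov product is exponentially long.\<close>

lemma walk_far_from_point:
  assumes "walk n w" "p \<in> V" and far: "\<And>i. i \<le> n \<Longrightarrow> r \<le> D p (w i)"
  shows "i + m \<le> n \<Longrightarrow> m \<le> 2 ^ k \<Longrightarrow>
    D (w i) (w (i + m)) + 2 * r \<le> D p (w i) + D p (w (i + m)) + 1 + k * \<delta>"
proof (induction k arbitrary: i m)
  case 0
  then show ?case using far[of i] far[of "i + m"] walk_D_le[OF assms(1) 0(1)] by auto
next
  case (Suc k)
  define m1 m2 where "m1 = m div 2" and "m2 = m - m1"
  have m: "m = m1 + m2" "m1 \<le> 2 ^ k" "m2 \<le> 2 ^ k" using Suc by (auto simp: m1_def m2_def)
  have V: "w i \<in> V" "w (i + m1) \<in> V" "w (i + m) \<in> V" using assms Suc m by (auto simp: walk_def)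
  have 1: "D (w i) (w (i + m1)) + 2 * r \<le> D p (w i) + D p (w (i + m1)) + 1 + k * \<delta>"
    using Suc.IH[of i m1] Suc m by auto
  have 2: "D (w (i + m1)) (w (i + m)) + 2 * r \<le> D p (w (i + m1)) + D p (w (i + m)) + 1 + k * \<delta>"
    using Suc.IH[of "i + m1" m2] Suc m by (auto simp: add.assoc)
  have "D (w i) (w (i + m)) + D p (w (i + m1)) \<le>
      max (D (w i) p + D (w (i + m)) (w (i + m1))) (D (w i) (w (i + m1)) + D (w (i + m)) p) + \<delta>"
    using four_point V assms by auto
  with 1 2 D_sym[OF V(1) assms(2)] D_sym[OF V(3) assms(2)] D_sym[OF V(3) V(2)]
  show ?case by (auto simp: max_def split: if_splits)
qed

text \<open>The centre lies on a geodesic from \<open>x\<close> to \<open>y\<close>, at distance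
  from \<open>x\<close> equal to the Gromov product of \<open>y\<close> and \<open>z\<close> at
  \<open>x\<close>, rounded down. The four-point inequality bounds its distance to \<open>z\<close>;
  the summand 2 leaves room for the rounding.\<close>

lemma geodesic_triangle_center:
  assumes V: "x \<in> V" "y \<in> V" "z \<in> V"
  shows "\<exists>p\<in>V. D x p + D p y \<le> D x y + (\<delta> + 2) \<and> D y p + D p z \<le> D y z + (\<delta> + 2) \<and>
               D z p + D p x \<le> D z x + (\<delta> + 2)"
proof -
  obtain w where w: "walk (D x y) w" "w 0 = x" "w (D x y) = y" using geodesic_walk V by blast
  define i where "i = (D x y + D x z - D y z) div 2"
  have t: "D y z \<le> D x y + D x z" "D x z \<le> D x y + D y z"
    using D_triangle[of y x z] D_triangle[of x y z] D_sym V by auto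
  then have il: "i \<le> D x y" by (auto simp: i_def)
  define p where "p = w i"
  have p: "p \<in> V" using w il by (auto simp: p_def walk_def)
  have "D x p \<le> i" "D p y \<le> D x y - i"
    using walk_D_le[OF w(1), of 0 i] walk_D_le[OF w(1), of i "D x y - i"] il w by (auto simp: p_def)
  moreover have "2 * i \<le> D x y + D x z - D y z" "D x y + D x z - D y z \<le> 2 * i + 1"
    by (auto simp: i_def)
  moreover have "D p z + D x y \<le> max (D p x + D z y) (D p y + D z x) + \<delta>"
    using four_point p V by auto
  ultimately show ?thesis using t il D_sym p V
    by (intro bexI[of _ p]) (auto simp: max_def split: if_splits)
qed

end

section \<open>Stability of quasigeodesics\<close>

lemma linear_le_exp: "2 * M + 2 \<le> j \<Longrightarrow> M * (j + 1) \<le> 2 ^ j" for M j :: nat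
proof (induction j rule: dec_induct)
  case base
  have "M < 2 ^ M" by (rule less_exp)
  then have "M + 1 \<le> 2 ^ M" by linarith
  from mult_mono[OF this this] have "(M + 1) * (M + 1) \<le> 2 ^ M * 2 ^ M" by simp
  moreover have "M * (2 * M + 2 + 1) \<le> 4 * ((M + 1) * (M + 1))" by (simp add: algebra_simps)
  ultimately have "M * (2 * M + 2 + 1) \<le> 4 * (2 ^ M * 2 ^ M)" by linarith
  then show ?case by (simp add: power_add mult_2)
next
  case (step j)
  then show ?case by (simp add: algebra_simps)
qed

text \<open>The Morse argument bounds \<open>r\<close> by about \<delta> times the logarithm of
  \<open>r\<close>, expressed here through powers of 2. Taking \<open>k = r div Suc \<delta>\<close>
  gives \<open>k * \<delta> \<le> r\<close>, hence \<open>r \<le> 1 + 2 * \<delta>\<close>; this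
  \<open>k\<close> is admissible for large \<open>r\<close> because an exponential outgrows a linear
  function.\<close>

lemma logarithmic_growth_bound:
  fixes c \<delta> :: nat
  shows "\<exists>R. \<forall>r. (\<forall>k. c * r \<le> 2 ^ k \<longrightarrow> 2 * r \<le> 1 + k * \<delta> + 2 * \<delta>) \<longrightarrow> r \<le> R"
proof (intro exI allI impI)
  fix r :: nat
  assume H: "\<forall>k. c * r \<le> 2 ^ k \<longrightarrow> 2 * r \<le> 1 + k * \<delta> + 2 * \<delta>"
  define q M where "q = Suc \<delta>" and "M = c * q"
  define j where "j = r div q"
  show "r \<le> 2 * \<delta> + 1 + Suc (2 * M + 2) * q"
    unfolding M_def q_def
  proof (rule ccontr)
    assume "\<not> r \<le> 2 * \<delta> + 1 + Suc (2 * (c * Suc \<delta>) + 2) * Suc \<delta>"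
    then have r: "2 * \<delta> + 1 < r" "(2 * M + 2) * q \<le> r" unfolding q_def M_def by auto
    have "2 * M + 2 \<le> j" using r(2) by (simp add: j_def q_def less_eq_div_iff_mult_less_eq)
    then have e: "M * (j + 1) \<le> 2 ^ j" by (rule linear_le_exp)
    have "r \<le> (j + 1) * q" unfolding j_def q_def
      by (metis Suc_eq_plus1 dividend_less_div_times less_imp_le add.commute mult_Suc zero_less_Suc)
    then have "c * r \<le> M * (j + 1)" unfolding M_def by (simp add: mult.commute mult.left_commute)
    with e have "2 * r \<le> 1 + j * \<delta> + 2 * \<delta>" using H by auto
    moreover have "j * \<delta> \<le> r" unfolding j_def q_def
      by (metis div_times_less_eq_dividend le_trans mult_le_mono2 le_SucI order_refl)
    ultimately show False using r by auto
  qed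
qed

context hyperbolic_graph
begin

text \<open>Take a vertex \<open>p\<close> of the geodesic farthest from the walk, at distance
  \<open>r\<close>. Move \<open>2 * r\<close> along the geodesic to both sides and then at most
  \<open>r\<close> to the walk. The part of the walk in between has endpoints at most
  \<open>6 * r\<close> apart, hence at most \<open>L * 6 * r\<close> steps, and keeps distance
  \<open>r\<close> from \<open>p\<close>. Bisection makes the Gromov product of its endpoints at
  \<open>p\<close> almost \<open>r\<close>, whereas \<open>p\<close> lies on a geodesic; this bounds
  \<open>r\<close>.\<close>

lemma geodesic_near_quasigeodesic:
  "\<exists>R. \<forall>n w \<gamma> i. walk n w \<longrightarrow> (\<forall>i m. i + m \<le> n \<longrightarrow> m \<le> L * D (w i) (w (i + m))) \<longrightarrow>
      walk (D (w 0) (w n)) \<gamma> \<longrightarrow> \<gamma> 0 = w 0 \<longrightarrow> \<gamma> (D (w 0) (w n)) = w n \<longrightarrow> i \<le> D (w 0) (w n) \<longrightarrow>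
      (\<exists>j\<le>n. D (\<gamma> i) (w j) \<le> R)"
proof -
  obtain R where R: "\<And>r. (\<forall>k. L * 6 * r \<le> 2 ^ k \<longrightarrow> 2 * r \<le> 1 + k * \<delta> + 2 * \<delta>) \<Longrightarrow> r \<le> R"
    using logarithmic_growth_bound[of "L * 6" \<delta>] by auto
  show ?thesis
  proof (rule exI[of _ R], intro allI impI)
    fix n w \<gamma> i
    assume w: "walk n w" and qg: "\<forall>i m. i + m \<le> n \<longrightarrow> m \<le> L * D (w i) (w (i + m))"
      and g: "walk (D (w 0) (w n)) \<gamma>" "\<gamma> 0 = w 0" "\<gamma> (D (w 0) (w n)) = w n"
      and il: "i \<le> D (w 0) (w n)"
    define l where "l = D (w 0) (w n)"
    have V: "\<And>j. j \<le> n \<Longrightarrow> w j \<in> V" "\<And>i. i \<le> l \<Longrightarrow> \<gamma> i \<in> V" using w g by (auto simp: walk_def l_def)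
    have geo: "D (\<gamma> a) (\<gamma> c) = c - a" if "a \<le> c" "c \<le> l" for a c
    proof -
      have "D (\<gamma> a) (\<gamma> c) \<le> c - a" "D (\<gamma> 0) (\<gamma> a) \<le> a" "D (\<gamma> c) (\<gamma> l) \<le> l - c"
        using walk_D_le[OF g(1), of a "c - a"] walk_D_le[OF g(1), of 0 a] walk_D_le[OF g(1), of c "l - c"] that
        by (auto simp: l_def)
      moreover have "l \<le> D (\<gamma> 0) (\<gamma> a) + D (\<gamma> a) (\<gamma> c) + D (\<gamma> c) (\<gamma> l)"
        using D_triangle[of "\<gamma> 0" "\<gamma> a" "\<gamma> l"] D_triangle[of "\<gamma> a" "\<gamma> c" "\<gamma> l"] V that g by (auto simp: l_def)
      ultimately show ?thesis using that by linarith
    qed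
    define dist where "dist q = Min ((\<lambda>j. D q (w j)) ` {..n})" for q
    have dist_le: "dist q \<le> D q (w j)" if "j \<le> n" for q j using that by (auto simp: dist_def)
    have dist_ex: "\<exists>j\<le>n. D q (w j) = dist q" for q
    proof -
      have "dist q \<in> (\<lambda>j. D q (w j)) ` {..n}" unfolding dist_def by (intro Min_in) auto
      then show ?thesis by auto
    qed
    have "Max ((\<lambda>i. dist (\<gamma> i)) ` {..l}) \<in> (\<lambda>i. dist (\<gamma> i)) ` {..l}" by (intro Max_in) auto
    then obtain m where m: "m \<le> l" "Max ((\<lambda>i. dist (\<gamma> i)) ` {..l}) = dist (\<gamma> m)" by (metis (no_types, lifting) imageE atMost_iff)
    define r p where "r = dist (\<gamma> m)" and "p = \<gamma> m"
    have mx: "dist (\<gamma> i) \<le> r" if "i \<le> l" for i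
      using that m by (auto simp: r_def simp flip: m(2))
    have far: "r \<le> D p (w j)" if "j \<le> n" for j using dist_le that by (auto simp: r_def p_def)
    have p: "p \<in> V" using V m by (auto simp: p_def)
    \<comment> \<open>The last conjunct says that the Gromov product of \<open>\<gamma> a\<close>
      and \<open>w j\<close> at \<open>p\<close> is at least \<open>r\<close>. If fewer than
      \<open>2 * r\<close> steps remain on this side, the endpoint of the geodesic is taken, which
      lies on the walk.\<close>
    have left: "\<exists>a j. a \<le> m \<and> j \<le> n \<and> D (\<gamma> a) (w j) \<le> r \<and> D p (\<gamma> a) \<le> 2 * r \<and>
        D (\<gamma> a) (w j) + 2 * r \<le> D p (\<gamma> a) + D p (w j)"
    proof (cases "2 * r \<le> m")
      case True
      obtain j where j: "j \<le> n" "D (\<gamma> (m - 2 * r)) (w j) \<le> r" 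
        using dist_ex[of "\<gamma> (m - 2 * r)"] mx[of "m - 2 * r"] m by auto
      have "D p (\<gamma> (m - 2 * r)) = 2 * r"
        using geo[of "m - 2 * r" m] D_sym[of p "\<gamma> (m - 2 * r)"] p V True m by (auto simp: p_def)
      with j far[of j] show ?thesis by (intro exI[of _ "m - 2 * r"] exI[of _ j]) auto
    next
      case False
      have "D p (w 0) = m" using geo[of 0 m] D_sym[of p "\<gamma> 0"] p V m g by (auto simp: p_def)
      with False far[of 0] g D_self[of "w 0"] V(1)[of 0] show ?thesis
        by (intro exI[of _ 0]) auto
    qed
    have right: "\<exists>a j. m \<le> a \<and> a \<le> l \<and> j \<le> n \<and> D (\<gamma> a) (w j) \<le> r \<and> D p (\<gamma> a) \<le> 2 * r \<and>
        D (\<gamma> a) (w j) + 2 * r \<le> D p (\<gamma> a) + D p (w j)"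
    proof (cases "m + 2 * r \<le> l")
      case True
      obtain j where j: "j \<le> n" "D (\<gamma> (m + 2 * r)) (w j) \<le> r" 
        using dist_ex[of "\<gamma> (m + 2 * r)"] mx[of "m + 2 * r"] True by auto
      have "D p (\<gamma> (m + 2 * r)) = 2 * r" using geo[of m "m + 2 * r"] True by (auto simp: p_def)
      with j far[of j] True show ?thesis by (intro exI[of _ "m + 2 * r"] exI[of _ j]) auto
    next
      case False
      have "D p (w n) = l - m" using geo[of m l] m g by (auto simp: p_def l_def)
      with False far[of n] g D_self[of "w n"] V(1)[of n] m show ?thesis
        by (intro exI[of _ l] exI[of _ n]) (auto simp: l_def)
    qed
    obtain a j where a: "a \<le> m" "j \<le> n" "D (\<gamma> a) (w j) \<le> r" "D p (\<gamma> a) \<le> 2 * r"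
        "D (\<gamma> a) (w j) + 2 * r \<le> D p (\<gamma> a) + D p (w j)" using left by blast
    obtain c j' where c: "m \<le> c" "c \<le> l" "j' \<le> n" "D (\<gamma> c) (w j') \<le> r" "D p (\<gamma> c) \<le> 2 * r"
        "D (\<gamma> c) (w j') + 2 * r \<le> D p (\<gamma> c) + D p (w j')" using right by blast
    have Vs: "\<gamma> a \<in> V" "\<gamma> c \<in> V" "w j \<in> V" "w j' \<in> V" using V a c by auto
    have "r \<le> R"
    proof (rule R, intro allI impI)
      fix k :: nat assume k: "L * 6 * r \<le> 2 ^ k"
      have "D (w j) (w j') \<le> 6 * r"
        using D_triangle[of "w j" "\<gamma> a" "w j'"] D_triangle[of "\<gamma> a" p "w j'"] D_triangle[of p "\<gamma> c" "w j'"]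
          D_sym[of "w j" "\<gamma> a"] D_sym[of "\<gamma> a" p] Vs p a c by linarith
      then have d: "L * D (w j) (w j') \<le> 2 ^ k" using k mult_le_mono2[of "D (w j) (w j')" "6 * r" L]
        unfolding mult.assoc by linarith
      have middle: "D (w j) (w j') + 2 * r \<le> D p (w j) + D p (w j') + (1 + k * \<delta>)"
      proof (cases "j \<le> j'")
        case True
        then have "j' - j \<le> 2 ^ k" using qg[rule_format, of j "j' - j"] c(3) d by auto
        then show ?thesis
          using walk_far_from_point[OF w p far, of j "j' - j" k] True c(3) by auto
      next
        case False
        then have "j - j' \<le> 2 ^ k"
          using qg[rule_format, of j' "j - j'"] a(2) d D_sym[OF Vs(3,4)] by auto
        then show ?thesis
          using walk_far_from_point[OF w p far, of j' "j - j'" k] False a(2) D_sym[OF Vs(3,4)] by auto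
      qed
      \<comment> \<open>Chaining \<open>\<gamma> a\<close>, \<open>w j\<close>, \<open>w j'\<close>,
        \<open>\<gamma> c\<close> costs \<delta> twice, yet the Gromov product of
        \<open>\<gamma> a\<close> and \<open>\<gamma> c\<close> at \<open>p\<close> is zero.\<close>
      have "D (\<gamma> a) (w j') + 2 * r \<le> D p (\<gamma> a) + D p (w j') + (1 + k * \<delta>) + \<delta>"
        by (rule gromov_ultrametric[OF p _ _ Vs(3)]) (use Vs middle a in auto)
      then have "D (\<gamma> a) (\<gamma> c) + 2 * r \<le> D p (\<gamma> a) + D p (\<gamma> c) + ((1 + k * \<delta>) + \<delta>) + \<delta>"
        by (intro gromov_ultrametric[OF p _ _ Vs(4)]) (use Vs c D_sym[of "w j'" "\<gamma> c"] in auto)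
      moreover have "D (\<gamma> a) (\<gamma> c) = D p (\<gamma> a) + D p (\<gamma> c)"
        using geo[of a c] geo[of a m] geo[of m c] a c m D_sym[of p "\<gamma> a"] p Vs by (auto simp: p_def)
      ultimately show "2 * r \<le> 1 + k * \<delta> + 2 * \<delta>" by auto
    qed
    with dist_ex[of "\<gamma> i"] mx[of i] il show "\<exists>j\<le>n. D (\<gamma> i) (w j) \<le> R" by (fastforce simp: l_def)
  qed
qed

text \<open>By the four-point inequality \<open>p\<close> is within
  \<open>\<epsilon> + \<delta>\<close> of the geodesic vertex at the same distance from
  \<open>w 0\<close>, or within \<open>\<epsilon>\<close> of \<open>w n\<close> if it lies beyond
  that end. This form applies to centres of triangles, which are on none of the chosen geodesics in
  general.\<close>

lemma near_geodesic_near_quasigeodesic: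
  "\<exists>R. \<forall>n w p. walk n w \<longrightarrow> (\<forall>i m. i + m \<le> n \<longrightarrow> m \<le> L * D (w i) (w (i + m))) \<longrightarrow> p \<in> V \<longrightarrow>
      D (w 0) p + D p (w n) \<le> D (w 0) (w n) + \<epsilon> \<longrightarrow> (\<exists>j\<le>n. D p (w j) \<le> R)"
proof -
  obtain R where R: "\<And>n w \<gamma> i. walk n w \<Longrightarrow> (\<forall>i m. i + m \<le> n \<longrightarrow> m \<le> L * D (w i) (w (i + m))) \<Longrightarrow>
      walk (D (w 0) (w n)) \<gamma> \<Longrightarrow> \<gamma> 0 = w 0 \<Longrightarrow> \<gamma> (D (w 0) (w n)) = w n \<Longrightarrow> i \<le> D (w 0) (w n) \<Longrightarrow>
      \<exists>j\<le>n. D (\<gamma> i) (w j) \<le> R"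
    using geodesic_near_quasigeodesic by metis
  show ?thesis
  proof (rule exI[of _ "\<epsilon> + \<delta> + R"], intro allI impI)
    fix n w p
    assume w: "walk n w" and qg: "\<forall>i m. i + m \<le> n \<longrightarrow> m \<le> L * D (w i) (w (i + m))" and p: "p \<in> V"
      and e: "D (w 0) p + D p (w n) \<le> D (w 0) (w n) + \<epsilon>"
    define l where "l = D (w 0) (w n)"
    have V: "\<And>j. j \<le> n \<Longrightarrow> w j \<in> V" using w by (auto simp: walk_def)
    show "\<exists>j\<le>n. D p (w j) \<le> \<epsilon> + \<delta> + R"
    proof (cases "D (w 0) p \<le> l")
      case False
      then show ?thesis using e by (intro exI[of _ n]) (auto simp: l_def)
    next
      case True
      define i where "i = D (w 0) p"
      obtain \<gamma> where g: "walk l \<gamma>" "\<gamma> 0 = w 0" "\<gamma> l = w n"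
        using geodesic_walk[of "w 0" "w n"] V by (auto simp: l_def)
      have gi: "\<gamma> i \<in> V" using g True by (auto simp: i_def walk_def)
      obtain j where j: "j \<le> n" "D (\<gamma> i) (w j) \<le> R"
        using R[OF w qg, of \<gamma> i] g True by (auto simp: l_def i_def)
      have "D (w 0) (\<gamma> i) \<le> i" "D (\<gamma> i) (w n) \<le> l - i"
        using walk_D_le[OF g(1), of 0 i] walk_D_le[OF g(1), of i "l - i"] True g by (auto simp: i_def)
      moreover have "D p (\<gamma> i) + D (w 0) (w n) \<le>
          max (D p (w 0) + D (\<gamma> i) (w n)) (D p (w n) + D (\<gamma> i) (w 0)) + \<delta>"
        using four_point p gi V by auto
      ultimately have "D p (\<gamma> i) \<le> \<epsilon> + \<delta>"
        using e True D_sym[of p "w 0"] D_sym[of "\<gamma> i" "w 0"] p gi V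
        by (auto simp: l_def i_def max_def split: if_splits)
      then show ?thesis using j D_triangle[of p "\<gamma> i" "w j"] p gi V by fastforce
    qed
  qed
qed

end

section \<open>Edge weights and penalised walks\<close>

lemma greatest_int_bounded:
  fixes P :: "int \<Rightarrow> bool"
  assumes "P a" "\<And>v. P v \<Longrightarrow> v \<le> M"
  shows "P (GREATEST v. P v)" "P v \<Longrightarrow> v \<le> (GREATEST v. P v)"
proof -
  have "finite {v. P v \<and> a \<le> v}" by (rule finite_subset[of _ "{a..M}"]) (use assms in auto)
  moreover from this have m: "v \<le> Max {v. P v \<and> a \<le> v}" if "P v" "a \<le> v" for v using that by simp
  moreover have "{v. P v \<and> a \<le> v} \<noteq> {}" using assms by auto
  ultimately have in_set: "Max {v. P v \<and> a \<le> v} \<in> {v. P v \<and> a \<le> v}" by (intro Max_in)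
  from m have ub: "v \<le> Max {v. P v \<and> a \<le> v}" if "P v" for v using that in_set by (cases "a \<le> v") force+
  have "(GREATEST v. P v) = Max {v. P v \<and> a \<le> v}"
    by (rule Greatest_equality) (use in_set ub in auto)
  then show "P (GREATEST v. P v)" "P v \<Longrightarrow> v \<le> (GREATEST v. P v)" using in_set ub by auto
qed

text \<open>One bound \<open>B\<close> serves the whole family of weights, so that all constants
  below are uniform in the weight.\<close>

locale weighted_hyperbolic_graph = hyperbolic_graph V D \<delta>
  for V :: "'p set" and D \<delta> +
  fixes Ws :: "('p \<Rightarrow> 'p \<Rightarrow> int) set" and B :: "nat \<Rightarrow> int"
  assumes loop_weight_bound:
    "b \<in> Ws \<Longrightarrow> weighted_walk b x x n s \<Longrightarrow> n \<le> N \<Longrightarrow> \<bar>s\<bar> \<le> B N"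
begin

section \<open>The linear isoperimetric inequality\<close>

definition isoperimetric_const :: int where
  "isoperimetric_const = 2 * B (4 * Suc \<delta>)"

abbreviation "K\<^sub>0 \<equiv> isoperimetric_const"

lemma B_nonneg: "b \<in> Ws \<Longrightarrow> x \<in> V \<Longrightarrow> 0 \<le> B N"
  using loop_weight_bound[OF _ weighted_walk_Nil] by fastforce

text \<open>Closing both walks by the same return geodesic gives two loops of length at most
  \<open>4 * Suc \<delta>\<close>; hence the value of \<open>isoperimetric_const\<close>.\<close>

lemma parallel_walk_weights:
  assumes b: "b \<in> Ws" and s: "weighted_walk b x y n s" and t: "weighted_walk b x y m t"
    and "n \<le> 2 * Suc \<delta>" "m \<le> 2 * Suc \<delta>"
  shows "\<bar>s - t\<bar> \<le> K\<^sub>0"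
proof -
  have V: "x \<in> V" "y \<in> V" using weighted_walk_in_V s by blast+
  obtain r where r: "weighted_walk b y x (D y x) r" using geodesic_weighted_walk V by blast
  have "D y x \<le> 2 * Suc \<delta>" using weighted_walk_D_le[OF s] D_sym V assms by simp
  then have "\<bar>s + r\<bar> \<le> B (4 * Suc \<delta>)" "\<bar>t + r\<bar> \<le> B (4 * Suc \<delta>)"
    using loop_weight_bound[OF b weighted_walk_append[OF s r]]
      loop_weight_bound[OF b weighted_walk_append[OF t r]] assms by auto
  then show ?thesis unfolding isoperimetric_const_def by linarith
qed

theorem linear_isoperimetric:
  assumes b: "b \<in> Ws"
  shows "weighted_walk b x x n s \<Longrightarrow> \<bar>s\<bar> \<le> K\<^sub>0 * int n"
proof (induction n arbitrary: x s rule: less_induct)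
  case (less n)
  have xV: "x \<in> V" using weighted_walk_in_V less by blast
  have K0: "0 \<le> K\<^sub>0" using B_nonneg[OF b xV] by (simp add: isoperimetric_const_def)
  obtain w where w: "walk n w" "w 0 = x" "w n = x" "s = (\<Sum>i<n. b (w i) (w (Suc i)))"
    using less by (auto simp: weighted_walk_def)
  show ?case
  proof (cases "2 * Suc \<delta> \<le> n")
    case False
    show ?thesis
    proof (cases "n = 0")
      case True then show ?thesis using w by simp
    next
      case False
      have "\<bar>s\<bar> \<le> B (4 * Suc \<delta>)"
        using loop_weight_bound[OF b less(2)] \<open>\<not> 2 * Suc \<delta> \<le> n\<close> by auto
      moreover have "0 \<le> B (4 * Suc \<delta>)" by (rule B_nonneg[OF b xV])
      ultimately have "\<bar>s\<bar> \<le> K\<^sub>0 * 1" by (simp add: isoperimetric_const_def)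
      moreover have "K\<^sub>0 * 1 \<le> K\<^sub>0 * int n" using K0 False by (intro mult_left_mono) auto
      ultimately show ?thesis by linarith
    qed
  next
    case True
    obtain i m where im: "i + m \<le> n" "m \<le> 2 * Suc \<delta>" "D (w i) (w (i + m)) < m"
      using loop_shortcut[OF w(1) _ refl True] w by auto
    let ?p = "w i" and ?q = "w (i + m)"
    have V: "?p \<in> V" "?q \<in> V" using w im by (auto simp: walk_def)
    obtain s1 s2 s3 where s1: "weighted_walk b x ?p i s1" and s2: "weighted_walk b ?p ?q m s2"
      and s3: "weighted_walk b ?q x (n - (i + m)) s3" and s: "s = s1 + s2 + s3"
      using weighted_walk_split3[OF w(1) im(1) w(4)[symmetric]] w(2,3) by metis
    \<comment> \<open>The shortcut saves at least one step and changes the weight by at most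
      \<open>K\<^sub>0\<close>, which that step pays for.\<close>
    obtain t where t: "weighted_walk b ?p ?q (D ?p ?q) t" using geodesic_weighted_walk V by blast
    have "\<bar>s2 - t\<bar> \<le> K\<^sub>0" by (rule parallel_walk_weights[OF b s2 t]) (use im in auto)
    moreover
    define n' where "n' = i + D ?p ?q + (n - (i + m))"
    have n': "n' < n" using im by (auto simp: n'_def)
    have "\<bar>s1 + t + s3\<bar> \<le> K\<^sub>0 * int n'"
      using less.IH[OF n' weighted_walk_append[OF weighted_walk_append[OF s1 t] s3, folded n'_def]] .
    ultimately have "\<bar>s\<bar> \<le> K\<^sub>0 * int n' + K\<^sub>0" unfolding s by linarith
    moreover have "K\<^sub>0 * int n' + K\<^sub>0 = K\<^sub>0 * int (Suc n')" by (simp add: algebra_simps)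
    moreover have "K\<^sub>0 * int (Suc n') \<le> K\<^sub>0 * int n" using n' K0 by (intro mult_left_mono) auto
    ultimately show ?thesis by linarith
  qed
qed

text \<open>The slope of the length penalty exceeds the isoperimetric constant by one: this makes
  the maximum exist and optimal walks quasigeodesic.\<close>

definition peak :: "('p \<Rightarrow> 'p \<Rightarrow> int) \<Rightarrow> 'p \<Rightarrow> 'p \<Rightarrow> int" where
  "peak b x y = (GREATEST v. \<exists>n s. weighted_walk b x y n s \<and> v = s - (K\<^sub>0 + 1) * int n)"

lemma K0_nonneg: "b \<in> Ws \<Longrightarrow> x \<in> V \<Longrightarrow> 0 \<le> K\<^sub>0"
  using B_nonneg by (simp add: isoperimetric_const_def)

context
  fixes b x y
  assumes b: "b \<in> Ws" and V: "x \<in> V" "y \<in> V"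
begin

lemma penalised_weight_bounded:
  "\<exists>M. \<forall>n s. weighted_walk b x y n s \<longrightarrow> s - (K\<^sub>0 + 1) * int n \<le> M"
proof -
  obtain r where r: "weighted_walk b y x (D y x) r" using geodesic_weighted_walk V by blast
  show ?thesis
  proof (intro exI allI impI)
    fix n s assume s: "weighted_walk b x y n s"
    have "\<bar>s + r\<bar> \<le> K\<^sub>0 * int (n + D y x)"
      by (rule linear_isoperimetric[OF b weighted_walk_append[OF s r]])
    then show "s - (K\<^sub>0 + 1) * int n \<le> K\<^sub>0 * int (D y x) - r"
      by (simp add: algebra_simps abs_le_iff)
  qed
qed

lemma peak_attained:
  obtains n s where "weighted_walk b x y n s" "peak b x y = s - (K\<^sub>0 + 1) * int n"
proof -
  obtain t where t: "weighted_walk b x y (D x y) t" using geodesic_weighted_walk V by blast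
  obtain M where M: "\<And>n s. weighted_walk b x y n s \<Longrightarrow> s - (K\<^sub>0 + 1) * int n \<le> M"
    using penalised_weight_bounded by blast
  have "\<exists>n s. weighted_walk b x y n s \<and> peak b x y = s - (K\<^sub>0 + 1) * int n"
    unfolding peak_def
    by (rule greatest_int_bounded(1)[where M = M and P = "\<lambda>v. \<exists>n s. weighted_walk b x y n s \<and> v = s - (K\<^sub>0 + 1) * int n"])
      (use t M in blast)+
  then show ?thesis using that by blast
qed

lemma peak_upper:
  assumes "weighted_walk b x y n s"
  shows "s - (K\<^sub>0 + 1) * int n \<le> peak b x y"
proof -
  obtain M where M: "\<And>n s. weighted_walk b x y n s \<Longrightarrow> s - (K\<^sub>0 + 1) * int n \<le> M"
    using penalised_weight_bounded by blast
  show ?thesis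
    unfolding peak_def
    by (rule greatest_int_bounded(2)[where M = M and P = "\<lambda>v. \<exists>n s. weighted_walk b x y n s \<and> v = s - (K\<^sub>0 + 1) * int n"])
      (use assms M in blast)+
qed

end

section \<open>Superadditivity, transport and coarse additivity of the maxima\<close>

lemma peak_superadditive:
  assumes b: "b \<in> Ws" and V: "x \<in> V" "y \<in> V" "z \<in> V"
  shows "peak b x y + peak b y z \<le> peak b x z"
proof -
  obtain n s where s: "weighted_walk b x y n s" "peak b x y = s - (K\<^sub>0 + 1) * int n"
    using peak_attained b V by metis
  obtain m t where t: "weighted_walk b y z m t" "peak b y z = t - (K\<^sub>0 + 1) * int m"
    using peak_attained b V by metis
  show ?thesis using peak_upper[OF b V(1,3) weighted_walk_append[OF s(1) t(1)]] s t
    by (simp add: algebra_simps)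
qed

lemma peak_transport_le:
  assumes b: "b \<in> Ws" "b' \<in> Ws"
    and T: "\<And>x. x \<in> V \<Longrightarrow> T x \<in> V" "\<And>x y. x \<in> V \<Longrightarrow> y \<in> V \<Longrightarrow> D (T x) (T y) = D x y"
    and h: "\<And>x y. x \<in> V \<Longrightarrow> y \<in> V \<Longrightarrow> b (T x) (T y) = b' x y + h y - h x"
    and V: "x \<in> V" "y \<in> V"
  shows "peak b' x y + h y - h x \<le> peak b (T x) (T y)"
proof -
  obtain n s where s: "weighted_walk b' x y n s" "peak b' x y = s - (K\<^sub>0 + 1) * int n"
    using peak_attained[OF b(2) V] .
  have "weighted_walk b (T x) (T y) n (s + h y - h x)"
    by (rule weighted_walk_transport[where b' = b']) (use T h s in auto)
  from peak_upper[OF b(1) _ _ this] T V show ?thesis using s by auto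
qed

text \<open>The inverse map carries walks back, with \<open>- h (T' z)\<close> in place of
  \<open>h z\<close>, and so gives the other inequality. The lemma serves left translations and,
  with the identity map, weights known to agree only on \<open>V\<close>.\<close>

lemma peak_transport:
  assumes b: "b \<in> Ws" "b' \<in> Ws"
    and T: "\<And>x. x \<in> V \<Longrightarrow> T x \<in> V" "\<And>x y. x \<in> V \<Longrightarrow> y \<in> V \<Longrightarrow> D (T x) (T y) = D x y"
    and T': "\<And>x. x \<in> V \<Longrightarrow> T' x \<in> V" "\<And>x. x \<in> V \<Longrightarrow> T (T' x) = x" "\<And>x. x \<in> V \<Longrightarrow> T' (T x) = x"
    and h: "\<And>x y. x \<in> V \<Longrightarrow> y \<in> V \<Longrightarrow> b (T x) (T y) = b' x y + h y - h x"
    and V: "x \<in> V" "y \<in> V"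
  shows "peak b (T x) (T y) = peak b' x y + h y - h x"
proof (rule antisym)
  have "peak b (T x) (T y) + (\<lambda>z. - h (T' z)) (T y) - (\<lambda>z. - h (T' z)) (T x) \<le> peak b' (T' (T x)) (T' (T y))"
  proof (rule peak_transport_le[OF b(2,1)])
    fix u v assume "u \<in> V" "v \<in> V"
    then show "D (T' u) (T' v) = D u v" using T(2)[of "T' u" "T' v"] T' by auto
    show "b' (T' u) (T' v) = b u v + - h (T' v) - - h (T' u)"
      using h[of "T' u" "T' v"] T' \<open>u \<in> V\<close> \<open>v \<in> V\<close> by auto
  qed (use T T' V in auto)
  then show "peak b (T x) (T y) \<le> peak b' x y + h y - h x" using T' V by auto
  show "peak b' x y + h y - h x \<le> peak b (T x) (T y)"
    by (rule peak_transport_le) (use assms in auto)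
qed

text \<open>Geodesics out and back form a loop. Per unit of distance its weight loses at most
  \<open>2 * K\<^sub>0\<close> and its penalty is \<open>2 * (K\<^sub>0 + 1)\<close>.\<close>

lemma peak_round_trip:
  assumes b: "b \<in> Ws" and V: "x \<in> V" "y \<in> V"
  shows "- ((4 * K\<^sub>0 + 2) * int (D x y)) \<le> peak b x y + peak b y x"
proof -
  obtain s where s: "weighted_walk b x y (D x y) s" using geodesic_weighted_walk V by blast
  obtain t where t: "weighted_walk b y x (D y x) t" using geodesic_weighted_walk V by blast
  have "\<bar>s + t\<bar> \<le> K\<^sub>0 * int (D x y + D y x)"
    by (rule linear_isoperimetric[OF b weighted_walk_append[OF s t]])
  then have "- (K\<^sub>0 * (2 * int (D x y))) \<le> s + t" using D_sym[OF V] by simp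
  moreover have "s - (K\<^sub>0 + 1) * int (D x y) \<le> peak b x y" "t - (K\<^sub>0 + 1) * int (D x y) \<le> peak b y x"
    using peak_upper[OF b V s] peak_upper[OF b V(2,1) t] D_sym[OF V] by simp_all
  ultimately show ?thesis by (simp add: algebra_simps)
qed

text \<open>Replacing a segment of length \<open>m\<close> by a geodesic of length \<open>d\<close>
  saves a penalty of \<open>(K\<^sub>0 + 1) * (m - d)\<close> and loses weight at most
  \<open>K\<^sub>0 * (m + 3 * d)\<close>. Optimality makes the saving at most the loss, and the
  extra 1 in the slope leaves \<open>m \<le> (4 * K\<^sub>0 + 1) * d\<close>.\<close>

lemma optimal_walk_quasigeodesic:
  assumes b: "b \<in> Ws" and w: "walk n w" and im: "i + m \<le> n"
    and opt: "peak b (w 0) (w n) = (\<Sum>k<n. b (w k) (w (Suc k))) - (K\<^sub>0 + 1) * int n"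
  shows "m \<le> nat (4 * K\<^sub>0 + 1) * D (w i) (w (i + m))"
proof -
  let ?p = "w i" and ?q = "w (i + m)"
  have V: "w 0 \<in> V" "?p \<in> V" "?q \<in> V" "w n \<in> V" using w im by (auto simp: walk_def)
  obtain s1 s2 s3 where walks: "weighted_walk b (w 0) ?p i s1" "weighted_walk b ?p ?q m s2"
      "weighted_walk b ?q (w n) (n - (i + m)) s3"
    and s: "(\<Sum>k<n. b (w k) (w (Suc k))) = s1 + s2 + s3"
    by (rule weighted_walk_split3[OF w im refl, of b]) (rule that)
  obtain t where t: "weighted_walk b ?p ?q (D ?p ?q) t" using geodesic_weighted_walk V by blast
  obtain r where r: "weighted_walk b ?q ?p (D ?q ?p) r" using geodesic_weighted_walk V by blast
  have "\<bar>s2 + r\<bar> \<le> K\<^sub>0 * int (m + D ?q ?p)" "\<bar>t + r\<bar> \<le> K\<^sub>0 * int (D ?p ?q + D ?q ?p)"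
    by (rule linear_isoperimetric[OF b weighted_walk_append[OF walks(2) r]]
        linear_isoperimetric[OF b weighted_walk_append[OF t r]])+
  then have "s2 - t \<le> K\<^sub>0 * (int m + 3 * int (D ?p ?q))"
    unfolding D_sym[OF V(3,2)] by (simp add: algebra_simps abs_le_iff)
  moreover have "s1 + t + s3 - (K\<^sub>0 + 1) * int (i + D ?p ?q + (n - (i + m))) \<le> peak b (w 0) (w n)"
    by (rule peak_upper[OF b V(1,4) weighted_walk_append[OF weighted_walk_append[OF walks(1) t] walks(3)]])
  moreover have len: "int (i + D ?p ?q + (n - (i + m))) = int n + int (D ?p ?q) - int m" using im by simp
  ultimately have "s2 - t \<le> K\<^sub>0 * (int m + 3 * int (D ?p ?q))"
    "s1 + t + s3 - (K\<^sub>0 + 1) * (int n + int (D ?p ?q) - int m) \<le> s1 + s2 + s3 - (K\<^sub>0 + 1) * int n"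
    unfolding opt s len by simp_all
  then have "int m \<le> (4 * K\<^sub>0 + 1) * int (D ?p ?q)" by (simp add: algebra_simps)
  also have "\<dots> = int (nat (4 * K\<^sub>0 + 1) * D ?p ?q)" using K0_nonneg[OF b V(1)] by simp
  finally show ?thesis by linarith
qed

text \<open>Stability puts a vertex \<open>q\<close> of an optimal walk within \<open>R\<close> of
  \<open>p\<close>, and cutting the walk at \<open>q\<close> loses nothing. By superadditivity,
  moving the cut to \<open>p\<close> costs at most the round trip between \<open>p\<close> and
  \<open>q\<close>.\<close>

lemma peak_almost_additive:
  "\<exists>C. \<forall>b\<in>Ws. \<forall>x\<in>V. \<forall>y\<in>V. \<forall>p\<in>V. D x p + D p y \<le> D x y + \<epsilon> \<longrightarrow>
     \<bar>peak b x y - (peak b x p + peak b p y)\<bar> \<le> C"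
proof -
  obtain R where R: "\<forall>n w p. walk n w \<longrightarrow>
      (\<forall>i m. i + m \<le> n \<longrightarrow> m \<le> nat (4 * K\<^sub>0 + 1) * D (w i) (w (i + m))) \<longrightarrow> p \<in> V \<longrightarrow>
      D (w 0) p + D p (w n) \<le> D (w 0) (w n) + \<epsilon> \<longrightarrow> (\<exists>j\<le>n. D p (w j) \<le> R)"
    using near_geodesic_near_quasigeodesic ..
  show ?thesis
  proof (intro exI ballI impI)
    fix b x y p
    assume b: "b \<in> Ws" and V: "x \<in> V" "y \<in> V" "p \<in> V" and e: "D x p + D p y \<le> D x y + \<epsilon>"
    obtain n s where s: "weighted_walk b x y n s" "peak b x y = s - (K\<^sub>0 + 1) * int n"
      using peak_attained[OF b V(1,2)] .
    then obtain w where w: "walk n w" "w 0 = x" "w n = y" "s = (\<Sum>i<n. b (w i) (w (Suc i)))"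
      by (auto simp: weighted_walk_def)
    have "m \<le> nat (4 * K\<^sub>0 + 1) * D (w i) (w (i + m))" if "i + m \<le> n" for i m
      by (rule optimal_walk_quasigeodesic[OF b w(1) that]) (use w s in simp)
    with R[rule_format, OF w(1) _ V(3)] e w(2,3) obtain j where j: "j \<le> n" "D p (w j) \<le> R" by blast
    let ?q = "w j"
    have q: "?q \<in> V" using w j by (auto simp: walk_def)
    obtain s1 s2 where s12: "weighted_walk b x ?q j s1" "weighted_walk b ?q y (n - j) s2" "s = s1 + s2"
      by (rule weighted_walk_split[OF w(1) j(1) w(4)[symmetric], unfolded w(2,3)]) (rule that)
    have "(K\<^sub>0 + 1) * int n = (K\<^sub>0 + 1) * int j + (K\<^sub>0 + 1) * int (n - j)"
      unfolding distrib_left[symmetric] using j by simp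
    then have "peak b x y \<le> peak b x ?q + peak b ?q y"
      using peak_upper[OF b V(1) q s12(1)] peak_upper[OF b q V(2) s12(2)] s(2) s12(3) by linarith
    moreover have "peak b x ?q + peak b ?q p \<le> peak b x p" "peak b p ?q + peak b ?q y \<le> peak b p y"
      "peak b x p + peak b p y \<le> peak b x y"
      using peak_superadditive b V q by auto
    moreover have "- ((4 * K\<^sub>0 + 2) * int (D p ?q)) \<le> peak b p ?q + peak b ?q p"
      by (rule peak_round_trip[OF b V(3) q])
    moreover have "(4 * K\<^sub>0 + 2) * int (D p ?q) \<le> (4 * K\<^sub>0 + 2) * int R"
      using j K0_nonneg[OF b V(1)] by (intro mult_left_mono) auto
    ultimately show "\<bar>peak b x y - (peak b x p + peak b p y)\<bar> \<le> (4 * K\<^sub>0 + 2) * int R" by linarith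
  qed
qed

definition skew_peak :: "('p \<Rightarrow> 'p \<Rightarrow> int) \<Rightarrow> 'p \<Rightarrow> 'p \<Rightarrow> int" where
  "skew_peak b x y = peak b x y - peak b y x"

text \<open>Near the centre \<open>p\<close> of a geodesic triangle the contributions of each leg
  cancel, because it is traversed once in each direction.\<close>

theorem skew_peak_bounded_coboundary:
  "\<exists>C. \<forall>b\<in>Ws. \<forall>x\<in>V. \<forall>y\<in>V. \<forall>z\<in>V. \<bar>skew_peak b x y + skew_peak b y z + skew_peak b z x\<bar> \<le> C"
proof -
  obtain C where C: "\<And>b x y p. b \<in> Ws \<Longrightarrow> x \<in> V \<Longrightarrow> y \<in> V \<Longrightarrow> p \<in> V \<Longrightarrow>
     D x p + D p y \<le> D x y + (\<delta> + 2) \<Longrightarrow> \<bar>peak b x y - (peak b x p + peak b p y)\<bar> \<le> C"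
    using peak_almost_additive[of "\<delta> + 2"] by metis
  have two: "\<bar>skew_peak b x y - (skew_peak b x p + skew_peak b p y)\<bar> \<le> 2 * C"
    if "b \<in> Ws" "x \<in> V" "y \<in> V" "p \<in> V" "D x p + D p y \<le> D x y + (\<delta> + 2)" for b x y p
  proof -
    have "D y p + D p x \<le> D y x + (\<delta> + 2)"
      using that D_sym[of x y] D_sym[of x p] D_sym[of y p] by simp
    then show ?thesis
      using C[OF that] C[OF that(1,3,2,4)] unfolding skew_peak_def by linarith
  qed
  show ?thesis
  proof (intro exI ballI)
    fix b x y z assume b: "b \<in> Ws" and V: "x \<in> V" "y \<in> V" "z \<in> V"
    obtain p where p: "p \<in> V" "D x p + D p y \<le> D x y + (\<delta> + 2)" "D y p + D p z \<le> D y z + (\<delta> + 2)"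
       "D z p + D p x \<le> D z x + (\<delta> + 2)"
      using geodesic_triangle_center[OF V] by blast
    have "skew_peak b p q = - skew_peak b q p" for q by (simp add: skew_peak_def)
    with two[OF b V(1,2) p(1,2)] two[OF b V(2,3) p(1,3)] two[OF b V(3,1) p(1,4)]
    show "\<bar>skew_peak b x y + skew_peak b y z + skew_peak b z x\<bar> \<le> 6 * C"
      by (smt (verit))
  qed
qed

end

section \<open>Coordinates on finitely generated abelian groups\<close>

context comm_group
begin

definition int_comb :: "'a set \<Rightarrow> ('a \<Rightarrow> int) \<Rightarrow> 'a" where
  "int_comb T n = (\<Otimes>t\<in>T. t [^] n t)"

lemma int_comb_closed [simp]: "T \<subseteq> carrier G \<Longrightarrow> int_comb T n \<in> carrier G"
  unfolding int_comb_def by (intro finprod_closed) auto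

lemma int_comb_add:
  "T \<subseteq> carrier G \<Longrightarrow> int_comb T (\<lambda>t. n t + m t) = int_comb T n \<otimes> int_comb T m"
proof -
  assume T: "T \<subseteq> carrier G"
  have "int_comb T (\<lambda>t. n t + m t) = (\<Otimes>t\<in>T. t [^] n t \<otimes> t [^] m t)"
    unfolding int_comb_def by (rule finprod_cong') (use T in \<open>auto simp: int_pow_mult subset_iff\<close>)
  also have "\<dots> = int_comb T n \<otimes> int_comb T m"
    unfolding int_comb_def by (rule finprod_multf) (use T in auto)
  finally show ?thesis .
qed

lemma int_comb_zero [simp]: "int_comb T (\<lambda>_. 0) = \<one>"
  by (simp add: int_comb_def)

lemma int_comb_uminus: "T \<subseteq> carrier G \<Longrightarrow> int_comb T (\<lambda>t. - n t) = inv (int_comb T n)"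
  using int_comb_add[of T "\<lambda>t. - n t" n] by (auto intro: inv_equality[symmetric])

lemma int_comb_pow:
  assumes "finite T" "T \<subseteq> carrier G"
  shows "int_comb T n [^] k = int_comb T (\<lambda>t. k * n t)"
  using assms
proof (induction T)
  case empty
  then show ?case by (simp add: int_comb_def)
next
  case (insert t T)
  then have "int_comb (insert t T) n [^] k = (t [^] n t) [^] k \<otimes> int_comb T n [^] k"
    by (simp add: int_comb_def Pi_def subset_iff int_pow_distrib)
  then show ?case using insert
    by (simp add: int_comb_def Pi_def subset_iff int_pow_pow mult.commute)
qed

lemma int_comb_cong: "(\<And>t. t \<in> T \<Longrightarrow> n t = m t) \<Longrightarrow> T \<subseteq> carrier G \<Longrightarrow> int_comb T n = int_comb T m"
  unfolding int_comb_def by (rule finprod_cong') auto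

lemma int_comb_insert:
  "finite T \<Longrightarrow> t \<notin> T \<Longrightarrow> insert t T \<subseteq> carrier G \<Longrightarrow> int_comb (insert t T) n = t [^] n t \<otimes> int_comb T n"
  unfolding int_comb_def by (rule finprod_insert) auto

lemma int_comb_single:
  assumes "finite T" "T \<subseteq> carrier G" "t \<in> T"
  shows "int_comb T (\<lambda>s. if s = t then k else 0) = t [^] k"
proof -
  have T: "T = insert t (T - {t})" using assms by auto
  have "int_comb (T - {t}) (\<lambda>s. if s = t then k else 0) = int_comb (T - {t}) (\<lambda>_. 0)"
    by (rule int_comb_cong) (use assms in auto)
  then show ?thesis
    by (subst T, subst int_comb_insert) (use assms in auto)
qed

lemma generate_int_comb:
  assumes "finite T" "T \<subseteq> carrier G" "a \<in> generate G T"
  shows "\<exists>n. a = int_comb T n"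
  using assms(3)
proof induction
  case one
  show ?case by (rule exI[of _ "\<lambda>_. 0"]) simp
next
  case (incl t)
  then show ?case
    using int_comb_single[OF assms(1,2), of t 1] assms by (metis int_pow_1 subsetD)
next
  case (inv t)
  then show ?case
    using int_comb_single[OF assms(1,2), of t "-1"] assms(2) int_pow_neg[of t 1]
    by (metis int_pow_1 subsetD)
next
  case (eng a b)
  then show ?case using int_comb_add[OF assms(2)] by metis
qed

section \<open>Independent generators and the torsion exponent\<close>

definition int_independent :: "'a set \<Rightarrow> bool" where
  "int_independent I \<longleftrightarrow> (\<forall>k. int_comb I k = \<one> \<longrightarrow> (\<forall>t\<in>I. k t = 0))"

lemma int_independent_eq:
  assumes "int_independent I" "I \<subseteq> carrier G" "int_comb I k = int_comb I l" "t \<in> I"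
  shows "k t = l t"
proof -
  have "int_comb I (\<lambda>t. k t + - l t) = \<one>"
    using assms int_comb_add[of I k "\<lambda>t. - l t"] int_comb_uminus[of I l] by simp
  then show ?thesis using assms unfolding int_independent_def by fastforce
qed

text \<open>Maximality yields a nontrivial relation between \<open>I\<close> and any further
  generator \<open>t\<close>. Its exponent at \<open>t\<close> is nonzero because \<open>I\<close>
  is independent, and a change of sign makes it positive.\<close>

lemma maximal_int_independent:
  assumes T: "finite T" "T \<subseteq> carrier G"
  obtains I where "I \<subseteq> T" "int_independent I" "\<And>t. t \<in> T \<Longrightarrow> \<exists>m>0. \<exists>k. t [^] (m::int) = int_comb I k"
proof -
  let ?P = "{I. I \<subseteq> T \<and> int_independent I}"
  have "finite ?P" by (rule finite_subset[of _ "Pow T"]) (use T in auto)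
  moreover have "{} \<in> ?P" by (simp add: int_independent_def)
  ultimately have "\<exists>I\<in>?P. \<forall>J\<in>?P. I \<subseteq> J \<longrightarrow> I = J" by (intro finite_has_maximal) auto
  then obtain I where I: "I \<in> ?P" and max: "\<And>J. J \<in> ?P \<Longrightarrow> I \<subseteq> J \<Longrightarrow> I = J"
    by meson
  have Ic: "finite I" "I \<subseteq> carrier G" using I T finite_subset by auto
  have "\<exists>m>0. \<exists>k. t [^] (m::int) = int_comb I k" if t: "t \<in> T" for t
  proof (cases "t \<in> I")
    case True
    then show ?thesis
      using int_comb_single[OF Ic, of t 1] by (metis zero_less_one)
  next
    case False
    have tc: "t \<in> carrier G" using t T by auto
    have "\<not> int_independent (insert t I)" using max[of "insert t I"] False t I by auto
    then obtain k s where k: "int_comb (insert t I) k = \<one>" "s \<in> insert t I" "k s \<noteq> 0"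
      unfolding int_independent_def by blast
    have eq: "t [^] k t \<otimes> int_comb I k = \<one>"
      using k(1) int_comb_insert[OF Ic(1) False] Ic tc by simp
    have "k t \<noteq> 0"
      using eq k(2,3) I Ic unfolding int_independent_def by auto
    moreover have "t [^] (- k t) = int_comb I k"
      using eq Ic tc by (metis int_comb_closed int_pow_closed int_pow_neg inv_equality m_comm)
    moreover have "t [^] k t = int_comb I (\<lambda>t. - k t)"
      using eq Ic tc by (simp add: int_comb_uminus inv_equality)
    ultimately show ?thesis
      by (metis linorder_neqE_linordered_idom neg_0_less_iff_less)
  qed
  then show ?thesis using that I by blast
qed

text \<open>The product of the exponents of the single generators works for all of them. When
  \<open>I\<close> is independent, this places all \<open>M\<close>-th powers in a free abelian
  subgroup, which stands in for splitting off the torsion.\<close>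

lemma common_torsion_exponent:
  assumes T: "finite T" "T \<subseteq> carrier G" and I: "finite I" "I \<subseteq> carrier G"
    and tor: "\<And>t. t \<in> T \<Longrightarrow> \<exists>m>0. \<exists>k. t [^] (m::int) = int_comb I k"
  obtains M :: int where "M > 0" "\<And>a. a \<in> generate G T \<Longrightarrow> \<exists>k. a [^] M = int_comb I k"
proof -
  obtain m where m: "\<And>t. t \<in> T \<Longrightarrow> m t > (0::int) \<and> (\<exists>k. t [^] m t = int_comb I k)"
    using tor by metis
  define M where "M = prod m T"
  have gen: "\<exists>k. t [^] M = int_comb I k" if t: "t \<in> T" for t
  proof -
    obtain d where d: "M = m t * d" unfolding M_def using dvd_prodI[OF T(1) t, of m] by auto
    obtain k where k: "t [^] m t = int_comb I k" using m t by blast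
    have "t [^] M = int_comb I k [^] d" using t T by (simp add: d int_pow_pow k[symmetric] subset_iff)
    then show ?thesis using int_comb_pow[OF I] by metis
  qed
  have "\<exists>k. a [^] M = int_comb I k" if "a \<in> generate G T" for a
    using that
  proof induction
    case one
    show ?case by (rule exI[of _ "\<lambda>_. 0"]) simp
  next
    case (incl t)
    then show ?case using gen by blast
  next
    case (inv t)
    then obtain k where k: "t [^] M = int_comb I k" using gen by blast
    have "inv t [^] M = int_comb I (\<lambda>t. - k t)"
      using inv T I int_pow_inv[of t M] k by (auto simp: int_comb_uminus)
    then show ?case by blast
  next
    case (eng a b)
    then obtain k l where "a [^] M = int_comb I k" "b [^] M = int_comb I l" by blast
    moreover have "a \<in> carrier G" "b \<in> carrier G" using eng generate_in_carrier[OF T(2)] by auto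
    ultimately have "(a \<otimes> b) [^] M = int_comb I (\<lambda>t. k t + l t)"
      using int_comb_add[OF I(2)] by (simp add: int_pow_distrib)
    then show ?case by blast
  qed
  moreover have "M > 0" unfolding M_def by (rule prod_pos) (use m in auto)
  ultimately show ?thesis using that by blast
qed

section \<open>Integer-valued functionals and coordinates\<close>

lemma hom_integer_mult:
  "\<psi> \<in> hom G integer_group \<Longrightarrow> a \<in> carrier G \<Longrightarrow> b \<in> carrier G \<Longrightarrow> \<psi> (a \<otimes> b) = \<psi> a + \<psi> b"
  using hom_mult[of \<psi> G integer_group] by simp

lemma hom_integer_one: "\<psi> \<in> hom G integer_group \<Longrightarrow> \<psi> \<one> = 0"
  using hom_integer_mult[of \<psi> \<one> \<one>] by simp

lemma hom_integer_inv: "\<psi> \<in> hom G integer_group \<Longrightarrow> a \<in> carrier G \<Longrightarrow> \<psi> (inv a) = - \<psi> a"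
  using hom_integer_mult[of \<psi> a "inv a"] hom_integer_one[of \<psi>] by simp

lemma hom_integer_pow: "\<psi> \<in> hom G integer_group \<Longrightarrow> a \<in> carrier G \<Longrightarrow> \<psi> (a [^] k) = k * \<psi> a" for k :: int
  using hom_int_pow[of \<psi> G integer_group a k] is_group by (simp add: mult.commute)

lemma hom_integer_finprod:
  assumes "\<psi> \<in> hom G integer_group" "finite I"
  shows "f \<in> I \<rightarrow> carrier G \<Longrightarrow> \<psi> (\<Otimes>i\<in>I. f i) = (\<Sum>i\<in>I. \<psi> (f i))"
  using assms(2) by (induction I rule: finite_induct) (use assms(1) in \<open>auto simp: hom_integer_one hom_integer_mult\<close>)

lemma hom_integer_int_comb:
  assumes "\<psi> \<in> hom G integer_group" "finite I" "I \<subseteq> carrier G"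
  shows "\<psi> (int_comb I k) = (\<Sum>i\<in>I. k i * \<psi> i)"
proof -
  have "\<psi> (int_comb I k) = (\<Sum>i\<in>I. \<psi> (i [^] k i))"
    unfolding int_comb_def by (rule hom_integer_finprod) (use assms in auto)
  also have "\<dots> = (\<Sum>i\<in>I. k i * \<psi> i)"
    by (rule sum.cong) (use assms in \<open>auto simp: hom_integer_pow subset_iff\<close>)
  finally show ?thesis .
qed

text \<open>The coordinate \<open>e i a\<close> is the exponent of \<open>i\<close> in the expansion
  of \<open>a [^] M\<close>; independence makes it unique, hence additive in \<open>a\<close>. The
  last property holds because coordinates separate the elements of each coset of the
  \<open>M\<close>-th powers, and reducing exponents modulo \<open>M\<close> leaves finitely many
  cosets.\<close>

lemma finitely_generated_coordinates:
  assumes T: "finite T" "T \<subseteq> carrier G" "generate G T = carrier G"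
  obtains I and M :: int and e where "finite I" "I \<subseteq> carrier G" "M > 0"
    "\<And>i. i \<in> I \<Longrightarrow> e i \<in> hom G integer_group"
    "\<And>a. a \<in> carrier G \<Longrightarrow> a [^] M = int_comb I (\<lambda>i. e i a)"
    "\<And>S. S \<subseteq> carrier G \<Longrightarrow> (\<And>i. i \<in> I \<Longrightarrow> finite (e i ` S)) \<Longrightarrow> finite S"
proof -
  obtain I where I: "I \<subseteq> T" "int_independent I" "\<And>t. t \<in> T \<Longrightarrow> \<exists>m>0. \<exists>k. t [^] (m::int) = int_comb I k"
    using maximal_int_independent[OF T(1,2)] by blast
  have Ic: "finite I" "I \<subseteq> carrier G" using I T finite_subset by auto
  obtain M :: int where M: "M > 0" "\<And>a. a \<in> carrier G \<Longrightarrow> \<exists>k. a [^] M = int_comb I k"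
    using common_torsion_exponent[OF T(1,2) Ic I(3)] T(3) by metis
  then obtain k where k: "\<And>a. a \<in> carrier G \<Longrightarrow> a [^] M = int_comb I (k a)" by metis
  define e where "e = (\<lambda>i a. k a i)"
  have hom: "e i \<in> hom G integer_group" if i: "i \<in> I" for i
  proof -
    have "k (a \<otimes> b) i = k a i + k b i" if "a \<in> carrier G" "b \<in> carrier G" for a b
    proof -
      have "int_comb I (k (a \<otimes> b)) = int_comb I (\<lambda>i. k a i + k b i)"
        using that k by (simp add: int_comb_add[OF Ic(2)] int_pow_distrib flip: k)
      then show ?thesis by (rule int_independent_eq[OF I(2) Ic(2) _ i])
    qed
    then show ?thesis by (auto simp: hom_def e_def)
  qed
  have fin: "finite S" if S: "S \<subseteq> carrier G" "\<And>i. i \<in> I \<Longrightarrow> finite (e i ` S)" for S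
  proof -
    define R where "R = int_comb T ` (PiE T (\<lambda>_. {0..<M}))"
    have "finite R" unfolding R_def using T by (intro finite_imageI finite_PiE) auto
    define P where "P r = {a \<in> S. \<exists>b\<in>carrier G. a = r \<otimes> b [^] M}" for r
    have "a \<in> (\<Union>r\<in>R. P r)" if a: "a \<in> S" for a
    proof -
      obtain n where n: "a = int_comb T n" using generate_int_comb[OF T(1,2)] T(3) S a by blast
      have "int_comb T (\<lambda>t. n t mod M) = int_comb T (restrict (\<lambda>t. n t mod M) T)"
        by (rule int_comb_cong) (use T in auto)
      then have "int_comb T (\<lambda>t. n t mod M) \<in> R" unfolding R_def using M(1) by (intro image_eqI) auto
      moreover have "a = int_comb T (\<lambda>t. n t mod M) \<otimes> int_comb T (\<lambda>t. n t div M) [^] M"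
        using T by (simp add: n int_comb_pow flip: int_comb_add)
      ultimately show ?thesis
        using a int_comb_closed[OF T(2)] unfolding P_def by (intro UN_I) auto
    qed
    then have "S \<subseteq> (\<Union>r\<in>R. P r)" by blast
    moreover have "finite (P r)" if r: "r \<in> R" for r
    proof -
      have rc: "r \<in> carrier G" using r T by (auto simp: R_def)
      \<comment> \<open>Equal coordinates of \<open>r \<otimes> b [^] M\<close> and
        \<open>r \<otimes> b' [^] M\<close> give equal coordinates of \<open>b\<close> and
        \<open>b'\<close>, as \<open>M > 0\<close>, and these determine \<open>b [^] M\<close> and
        \<open>b' [^] M\<close>.\<close>
      have "inj_on (\<lambda>a. restrict (\<lambda>i. e i a) I) (P r)"
      proof (rule inj_onI)
        fix a a' assume a: "a \<in> P r" "a' \<in> P r" and eq: "restrict (\<lambda>i. e i a) I = restrict (\<lambda>i. e i a') I"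
        obtain b b' where b: "b \<in> carrier G" "a = r \<otimes> b [^] M" "b' \<in> carrier G" "a' = r \<otimes> b' [^] M"
          using a by (auto simp: P_def)
        have "e i b = e i b'" if i: "i \<in> I" for i
        proof -
          have "e i a = e i a'" using fun_cong[OF eq, of i] i by simp
          then show ?thesis using b rc M(1) by (simp add: hom_integer_mult[OF hom[OF i]] hom_integer_pow[OF hom[OF i]])
        qed
        then have "int_comb I (k b) = int_comb I (k b')" by (intro int_comb_cong Ic) (simp add: e_def)
        then show "a = a'" using b k by simp
      qed
      moreover have "(\<lambda>a. restrict (\<lambda>i. e i a) I) ` P r \<subseteq> PiE I (\<lambda>i. e i ` S)" by (auto simp: P_def)
      moreover have "finite (PiE I (\<lambda>i. e i ` S))" using Ic S(2) by (intro finite_PiE) auto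
      ultimately show ?thesis by (meson finite_imageD finite_subset)
    qed
    ultimately show ?thesis using \<open>finite R\<close> by (meson finite_UN_I finite_subset)
  qed
  show ?thesis
    by (rule that[OF Ic M(1) hom _ fin]) (use k in \<open>auto simp: e_def\<close>)
qed

end

section \<open>The word metric\<close>

lemma (in group) inv_mult_cancel: "x \<in> carrier G \<Longrightarrow> y \<in> carrier G \<Longrightarrow> inv x \<otimes> (x \<otimes> y) = y"
  by (simp flip: m_assoc)

lemma (in group) mult_inv_cancel: "x \<in> carrier G \<Longrightarrow> y \<in> carrier G \<Longrightarrow> x \<otimes> (inv x \<otimes> y) = y"
  by (simp flip: m_assoc)

locale marked_group = group G for G (structure) +
  fixes S
  assumes finite_generators: "finite S" and generators_closed: "S \<subseteq> carrier G"
    and generators_generate: "generate G S = carrier G"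
begin

abbreviation letters where "letters \<equiv> S \<union> (\<lambda>s. inv s) ` S"
abbreviation eval_word where "eval_word ws \<equiv> foldr (\<lambda>x y. x \<otimes> y) ws \<one>"
abbreviation wlen where "wlen \<equiv> word_length G S"

lemma letters_closed: "letters \<subseteq> carrier G"
  using generators_closed by auto

lemma eval_word_closed: "set ws \<subseteq> letters \<Longrightarrow> eval_word ws \<in> carrier G"
proof (induction ws)
  case (Cons w ws)
  then have "w \<in> carrier G" using letters_closed by auto
  with Cons show ?case by simp
qed simp

lemma eval_word_append:
  "set us \<subseteq> letters \<Longrightarrow> set vs \<subseteq> letters \<Longrightarrow> eval_word (us @ vs) = eval_word us \<otimes> eval_word vs"
proof (induction us)
  case Nil
  then show ?case using eval_word_closed by simp
next
  case (Cons u us)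
  then have "u \<in> carrier G" using letters_closed by auto
  with Cons show ?case by (simp add: eval_word_closed m_assoc)
qed

lemma word_exists:
  assumes "g \<in> carrier G"
  shows "\<exists>ws. set ws \<subseteq> letters \<and> eval_word ws = g"
proof -
  have "g \<in> generate G S" using assms generators_generate by simp
  then show ?thesis
  proof induction
    case one
    show ?case by (rule exI[of _ "[]"]) simp
  next
    case (incl s)
    then show ?case using generators_closed by (intro exI[of _ "[s]"]) auto
  next
    case (inv s)
    then show ?case using generators_closed by (intro exI[of _ "[inv s]"]) auto
  next
    case (eng a b)
    then obtain u v where uv: "set u \<subseteq> letters" "eval_word u = a" "set v \<subseteq> letters" "eval_word v = b" by blast
    then have "set (u @ v) \<subseteq> letters \<and> eval_word (u @ v) = a \<otimes> b"
      by (simp add: eval_word_append del: foldr_append)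
    then show ?case by blast
  qed
qed

lemma geodesic_word:
  assumes "g \<in> carrier G"
  obtains ws where "set ws \<subseteq> letters" "eval_word ws = g" "length ws = wlen g"
proof -
  let ?P = "\<lambda>n. \<exists>ws. length ws = n \<and> set ws \<subseteq> letters \<and> eval_word ws = g"
  have "\<exists>n. ?P n" using word_exists[OF assms] by blast
  then have "?P (wlen g)" unfolding word_length_def by (rule LeastI_ex)
  then show ?thesis using that by blast
qed

lemma wlen_le: "set ws \<subseteq> letters \<Longrightarrow> eval_word ws = g \<Longrightarrow> wlen g \<le> length ws"
  unfolding word_length_def by (rule Least_le) auto

lemma wlen_one: "wlen \<one> = 0"
  using wlen_le[of "[]" \<one>] by simp

lemma wlen_eq_0: "g \<in> carrier G \<Longrightarrow> wlen g = 0 \<Longrightarrow> g = \<one>"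
  by (rule geodesic_word[of g]) auto

lemma wlen_mult_le:
  assumes "g \<in> carrier G" "h \<in> carrier G"
  shows "wlen (g \<otimes> h) \<le> wlen g + wlen h"
proof -
  obtain u v where uv: "set u \<subseteq> letters" "eval_word u = g" "length u = wlen g"
      "set v \<subseteq> letters" "eval_word v = h" "length v = wlen h"
    using geodesic_word assms by metis
  then show ?thesis using wlen_le[OF _ eval_word_append[of u v]] by simp
qed

lemma inv_letter: "s \<in> letters \<Longrightarrow> inv s \<in> letters"
  using generators_closed by auto

lemma eval_inverse_word:
  "set ws \<subseteq> letters \<Longrightarrow> set (rev (map (m_inv G) ws)) \<subseteq> letters \<and>
     eval_word (rev (map (m_inv G) ws)) = inv (eval_word ws)"
proof (induction ws)
  case (Cons w ws)
  then have w: "w \<in> carrier G" "eval_word ws \<in> carrier G" "inv w \<in> letters"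
    using letters_closed eval_word_closed inv_letter by auto
  have "eval_word (rev (map (m_inv G) ws) @ [inv w]) = inv (eval_word ws) \<otimes> eval_word [inv w]"
    using eval_word_append[of "rev (map (m_inv G) ws)" "[inv w]"] Cons w(3) by (simp del: foldr_append)
  then show ?case using Cons w by (simp add: inv_mult_group)
qed simp

lemma wlen_inv_le:
  assumes "g \<in> carrier G"
  shows "wlen (inv g) \<le> wlen g"
proof -
  obtain u where "set u \<subseteq> letters" "eval_word u = g" "length u = wlen g"
    using geodesic_word assms by metis
  then show ?thesis using eval_inverse_word[of u] wlen_le[of "rev (map (m_inv G) u)" "inv g"] by simp
qed

lemma wlen_inv: "g \<in> carrier G \<Longrightarrow> wlen (inv g) = wlen g"
  using wlen_inv_le[of g] wlen_inv_le[of "inv g"] by simp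

lemma wlen_Suc:
  assumes g: "g \<in> carrier G" "wlen g = Suc n"
  shows "\<exists>h\<in>carrier G. wlen h = n \<and> wlen (inv h \<otimes> g) = 1"
proof -
  obtain ws where ws: "set ws \<subseteq> letters" "eval_word ws = g" "length ws = Suc n"
    using geodesic_word g by metis
  then obtain us x where us: "ws = us @ [x]" "length us = n"
    by (metis length_Suc_conv_rev)
  define h where "h = eval_word us"
  have x: "x \<in> letters" "x \<in> carrier G" "set us \<subseteq> letters" using ws us letters_closed by auto
  have h: "h \<in> carrier G" unfolding h_def by (rule eval_word_closed[OF x(3)])
  have gh: "g = h \<otimes> x" using eval_word_append[of us "[x]"] us ws x
    by (simp add: h_def del: foldr_append)
  have "wlen h \<le> n" "wlen x \<le> 1"
    using wlen_le[OF x(3), of h] wlen_le[of "[x]" x] x us by (auto simp: h_def)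
  moreover have "Suc n \<le> wlen h + wlen x" using wlen_mult_le[OF h x(2)] gh g by simp
  moreover have "inv h \<otimes> g = x" using h x by (simp add: gh inv_mult_cancel)
  ultimately show ?thesis using h by (intro bexI[of _ h]) auto
qed

section \<open>The Cayley graph as a hyperbolic graph\<close>

definition wdist :: "'a \<Rightarrow> 'a \<Rightarrow> nat" where "wdist x y = wlen (inv x \<otimes> y)"

lemma wdist_left_mult:
  assumes "g \<in> carrier G" "x \<in> carrier G" "y \<in> carrier G"
  shows "wdist (g \<otimes> x) (g \<otimes> y) = wdist x y"
proof -
  have "inv (g \<otimes> x) \<otimes> (g \<otimes> y) = inv x \<otimes> y"
    using assms by (simp add: inv_mult_group m_assoc inv_mult_cancel)
  then show ?thesis by (simp add: wdist_def)
qed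

lemma finite_ball: "finite {g \<in> carrier G. wlen g \<le> n}"
proof (rule finite_subset)
  show "{g \<in> carrier G. wlen g \<le> n} \<subseteq> eval_word ` {ws. set ws \<subseteq> letters \<and> length ws \<le> n}"
  proof
    fix g assume g: "g \<in> {g \<in> carrier G. wlen g \<le> n}"
    obtain ws where "set ws \<subseteq> letters" "eval_word ws = g" "length ws = wlen g"
      using geodesic_word[of g] g by auto
    with g show "g \<in> eval_word ` {ws. set ws \<subseteq> letters \<and> length ws \<le> n}" by auto
  qed
  show "finite (eval_word ` {ws. set ws \<subseteq> letters \<and> length ws \<le> n})"
    using finite_generators by (intro finite_imageI finite_lists_length_le) auto
qed

text \<open>Doubling the inequality for Gromov products gives the four-point inequality with error
  \<open>2 * \<delta>\<close>, rounded up to a natural number. Prefixes of shortest words provide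
  the discrete geodesics.\<close>

lemma hyperbolic_graph_word_metric:
  fixes \<delta> :: real
  assumes hyp: "\<And>w x y z. w \<in> carrier G \<Longrightarrow> x \<in> carrier G \<Longrightarrow> y \<in> carrier G \<Longrightarrow> z \<in> carrier G \<Longrightarrow>
     gromov_product G S w x y \<ge> min (gromov_product G S w x z) (gromov_product G S w y z) - \<delta>"
  shows "hyperbolic_graph (carrier G) wdist (nat \<lceil>2 * \<delta>\<rceil>)"
proof -
  have sym: "wdist x y = wdist y x" if "x \<in> carrier G" "y \<in> carrier G" for x y
    using wlen_inv[of "inv x \<otimes> y"] that by (simp add: wdist_def inv_mult_group)
  show ?thesis
  proof
    fix x assume "x \<in> carrier G"
    then show "wdist x x = 0" by (simp add: wdist_def wlen_one)
  next
    fix x y assume xy: "x \<in> carrier G" "y \<in> carrier G"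
    then show "wdist x y = wdist y x" by (rule sym)
    { assume "wdist x y = 0"
      then have "inv x \<otimes> y = \<one>" using wlen_eq_0 xy by (simp add: wdist_def)
      then show "x = y" using xy by (metis inv_closed inv_equality inv_inv) }
    fix n assume "wdist x y = Suc n"
    then obtain h where h: "h \<in> carrier G" "wlen h = n" "wlen (inv h \<otimes> (inv x \<otimes> y)) = 1"
      using wlen_Suc[of "inv x \<otimes> y" n] xy by (auto simp: wdist_def)
    have "inv x \<otimes> (x \<otimes> h) = h" "inv (x \<otimes> h) \<otimes> y = inv h \<otimes> (inv x \<otimes> y)"
      using xy h by (simp_all add: inv_mult_group m_assoc inv_mult_cancel mult_inv_cancel)
    then show "\<exists>z\<in>carrier G. wdist x z = n \<and> wdist z y = 1"
      using h xy by (intro bexI[of _ "x \<otimes> h"]) (auto simp: wdist_def)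
  next
    fix x y z assume xyz: "x \<in> carrier G" "y \<in> carrier G" "z \<in> carrier G"
    have "inv x \<otimes> z = (inv x \<otimes> y) \<otimes> (inv y \<otimes> z)"
      using xyz by (simp add: m_assoc inv_mult_cancel mult_inv_cancel)
    then show "wdist x z \<le> wdist x y + wdist y z"
      using wlen_mult_le[of "inv x \<otimes> y" "inv y \<otimes> z"] xyz by (simp add: wdist_def)
  next
    fix x y z t assume p: "x \<in> carrier G" "y \<in> carrier G" "z \<in> carrier G" "t \<in> carrier G"
    have "real (wdist x y) + real (wdist z t) \<le>
        max (real (wdist x z) + real (wdist y t)) (real (wdist x t) + real (wdist y z)) + 2 * \<delta>"
      using hyp[OF p(4,1,2,3)] sym[of t x] sym[of t y] sym[of t z] p
      by (auto simp: gromov_product_def word_dist_def wdist_def[symmetric] min_def max_def field_simps split: if_splits)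
    also have "2 * \<delta> \<le> real (nat \<lceil>2 * \<delta>\<rceil>)" by linarith
    finally have "real (wdist x y + wdist z t) \<le>
        real (max (wdist x z + wdist y t) (wdist x t + wdist y z) + nat \<lceil>2 * \<delta>\<rceil>)" by simp
    then show "wdist x y + wdist z t \<le>
        max (wdist x z + wdist y t) (wdist x t + wdist y z) + nat \<lceil>2 * \<delta>\<rceil>"
      by (simp only: of_nat_le_iff)
  qed
qed

end

section \<open>Cocycles with twisted coefficients\<close>

locale twisted_cocycle = group G + A: comm_group A
  for G :: "('g, 'b) monoid_scheme" (structure) and A :: "('a, 'c) monoid_scheme" +
  fixes act :: "'g \<Rightarrow> 'a \<Rightarrow> 'a" and \<sigma> :: "'g \<Rightarrow> 'g \<Rightarrow> 'a"
  assumes action: "right_action_by_auts G A act"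
    and finite_image: "finite (action_image G A act)"
    and cocycle: "cocycle2 G A act \<sigma>"
begin

lemma act_hom: "g \<in> carrier G \<Longrightarrow> act g \<in> hom A A"
  using action by (auto simp: right_action_by_auts_def iso_def)

lemma act_closed [simp]: "g \<in> carrier G \<Longrightarrow> a \<in> carrier A \<Longrightarrow> act g a \<in> carrier A"
  using act_hom hom_in_carrier by metis

lemma act_mult: "g \<in> carrier G \<Longrightarrow> a \<in> carrier A \<Longrightarrow> b \<in> carrier A \<Longrightarrow>
    act g (a \<otimes>\<^bsub>A\<^esub> b) = act g a \<otimes>\<^bsub>A\<^esub> act g b"
  using act_hom hom_mult by metis

lemma act_one [simp]: "a \<in> carrier A \<Longrightarrow> act \<one> a = a"
  using action by (auto simp: right_action_by_auts_def)

lemma act_act: "g \<in> carrier G \<Longrightarrow> h \<in> carrier G \<Longrightarrow> a \<in> carrier A \<Longrightarrow> act h (act g a) = act (g \<otimes> h) a"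
  using action by (auto simp: right_action_by_auts_def)

lemma act_inv: "g \<in> carrier G \<Longrightarrow> a \<in> carrier A \<Longrightarrow> act g (inv\<^bsub>A\<^esub> a) = inv\<^bsub>A\<^esub> (act g a)"
  using group_hom.hom_inv[of A A "act g" a] act_hom[of g] A.is_group
  by (simp add: group_hom_def group_hom_axioms_def)

lemma hom_comp_act:
  assumes "\<psi> \<in> hom A integer_group" "g \<in> carrier G"
  shows "(\<lambda>a. \<psi> (act g a)) \<in> hom A integer_group"
  using assms by (simp add: hom_def Pi_def act_mult)

lemma finite_orbit:
  assumes "a \<in> carrier A"
  shows "finite ((\<lambda>k. act k a) ` carrier G)"
proof -
  have "(\<lambda>k. act k a) ` carrier G = (\<lambda>q. q a) ` action_image G A act"
    using assms by (auto simp: action_image_def image_image)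
  then show ?thesis using finite_image by simp
qed

lemma cocycle_closed [simp]: "g \<in> carrier G \<Longrightarrow> h \<in> carrier G \<Longrightarrow> \<sigma> g h \<in> carrier A"
  using cocycle by (auto simp: cocycle2_def)

lemma cocycle_eq:
  assumes "g \<in> carrier G" "h \<in> carrier G" "k \<in> carrier G"
  shows "\<sigma> g (h \<otimes> k) \<otimes>\<^bsub>A\<^esub> \<sigma> h k = act k (\<sigma> g h) \<otimes>\<^bsub>A\<^esub> \<sigma> (g \<otimes> h) k"
  using cocycle assms by (simp add: cocycle2_def A.m_assoc)

lemma cocycle_one_right: "g \<in> carrier G \<Longrightarrow> \<sigma> g \<one> = \<sigma> \<one> \<one>"
  using cocycle_eq[of g \<one> \<one>] by simp

text \<open>The homogeneous form of the cocycle, for the left action \<open>g \<cdot> a = a\<^sup>g\<^sup>-\<^sup>1\<close>.\<close>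

definition simplex :: "'g \<Rightarrow> 'g \<Rightarrow> 'g \<Rightarrow> 'a" where
  "simplex x y z = act (inv z) (\<sigma> (inv x \<otimes> y) (inv y \<otimes> z))"

lemma simplex_closed [simp]:
  "x \<in> carrier G \<Longrightarrow> y \<in> carrier G \<Longrightarrow> z \<in> carrier G \<Longrightarrow> simplex x y z \<in> carrier A"
  by (simp add: simplex_def)

lemma simplex_translate:
  assumes "g \<in> carrier G" "x \<in> carrier G" "y \<in> carrier G" "z \<in> carrier G"
  shows "simplex (g \<otimes> x) (g \<otimes> y) (g \<otimes> z) = act (inv g) (simplex x y z)"
proof -
  have "inv (g \<otimes> u) \<otimes> (g \<otimes> v) = inv u \<otimes> v" if "u \<in> carrier G" "v \<in> carrier G" for u v
    using that assms(1) by (simp add: inv_mult_group m_assoc inv_mult_cancel)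
  with assms show ?thesis by (simp add: simplex_def act_act inv_mult_group)
qed

lemma simplex_cocycle:
  assumes "x \<in> carrier G" "y \<in> carrier G" "z \<in> carrier G" "t \<in> carrier G"
  shows "simplex x y t \<otimes>\<^bsub>A\<^esub> simplex y z t = simplex x y z \<otimes>\<^bsub>A\<^esub> simplex x z t"
proof -
  define g h k where "g = inv x \<otimes> y" and "h = inv y \<otimes> z" and "k = inv z \<otimes> t"
  have c: "g \<in> carrier G" "h \<in> carrier G" "k \<in> carrier G" using assms by (simp_all add: g_def h_def k_def)
  have "g \<otimes> h = inv x \<otimes> z" "h \<otimes> k = inv y \<otimes> t" "k \<otimes> inv t = inv z"
    using assms by (simp_all add: g_def h_def k_def m_assoc mult_inv_cancel)
  then show ?thesis
    using arg_cong[OF cocycle_eq[OF c], of "act (inv t)"] c assms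
    by (simp add: simplex_def act_mult act_act flip: g_def h_def k_def)
qed

text \<open>The cocycle may fail to be normalised, so degenerate simplices need not vanish; their
  values stay in the finite orbit of \<open>\<sigma> \<one> \<one>\<close>, which is a bounded
  error.\<close>

lemma simplex_degenerate: "g \<in> carrier G \<Longrightarrow> simplex \<one> g g = act (inv g) (\<sigma> \<one> \<one>)"
  using cocycle_one_right[of g] by (simp add: simplex_def)

section \<open>Averaging over the finite image of the group\<close>

definition same_action :: "'g \<Rightarrow> 'g \<Rightarrow> bool" where
  "same_action k k' \<longleftrightarrow> (\<forall>a\<in>carrier A. act k a = act k' a)"

lemma same_action_mult_left:
  "same_action k k' \<Longrightarrow> g \<in> carrier G \<Longrightarrow> k \<in> carrier G \<Longrightarrow> k' \<in> carrier G \<Longrightarrow> same_action (g \<otimes> k) (g \<otimes> k')"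
  unfolding same_action_def by (metis act_act act_closed)

lemma same_action_inv:
  assumes "same_action k k'" "k \<in> carrier G" "k' \<in> carrier G"
  shows "same_action (inv k) (inv k')"
  unfolding same_action_def
proof
  fix a assume a: "a \<in> carrier A"
  have "act (inv k) a = act (inv k') (act k' (act (inv k) a))"
    using a assms by (simp add: act_act m_assoc)
  also have "act k' (act (inv k) a) = a"
    using a assms unfolding same_action_def by (metis act_act act_closed act_one inv_closed l_inv)
  finally show "act (inv k) a = act (inv k') a" .
qed

text \<open>\<open>R\<close> is a transversal for equality of actions. Left multiplication by
  \<open>g\<close> permutes the classes, so it preserves the sum over \<open>R\<close> of any
  function of the class: averaging over the finite image without forming the quotient.\<close>

lemma action_representatives:
  obtains R where "finite R" "R \<subseteq> carrier G" "R \<noteq> {}"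
    "\<And>F g. (\<And>k k'. k \<in> carrier G \<Longrightarrow> k' \<in> carrier G \<Longrightarrow> same_action k k' \<Longrightarrow> F k = F k') \<Longrightarrow>
       g \<in> carrier G \<Longrightarrow> (\<Sum>k\<in>R. F (g \<otimes> k)) = (\<Sum>k\<in>R. F k :: int)"
proof -
  define q where "q k = restrict (act k) (carrier A)" for k
  have same: "q k = q k' \<longleftrightarrow> same_action k k'" for k k'
    unfolding q_def same_action_def by (auto simp: restrict_def fun_eq_iff)
  obtain R where R: "R \<subseteq> carrier G" "inj_on q R" "q ` carrier G = q ` R"
    using subset_image_inj[of "q ` carrier G" q "carrier G"] by blast
  have "finite (q ` carrier G)" using finite_image by (simp add: action_image_def q_def[abs_def])
  then have fin: "finite R" using R finite_imageD by metis
  have "R \<noteq> {}" using R(3) by auto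
  moreover have "(\<Sum>k\<in>R. F (g \<otimes> k)) = (\<Sum>k\<in>R. F k :: int)"
    if F: "\<And>k k'. k \<in> carrier G \<Longrightarrow> k' \<in> carrier G \<Longrightarrow> same_action k k' \<Longrightarrow> F k = F k'"
      and g: "g \<in> carrier G" for F g
  proof -
    have "\<exists>r\<in>R. same_action (g \<otimes> k) r" if k: "k \<in> R" for k
    proof -
      have "q (g \<otimes> k) \<in> q ` R" unfolding R(3)[symmetric] using R(1) g k by auto
      then show ?thesis using same by auto
    qed
    then obtain p where p: "\<And>k. k \<in> R \<Longrightarrow> p k \<in> R \<and> same_action (g \<otimes> k) (p k)" by metis
    have inj: "inj_on p R"
    proof (rule inj_onI)
      fix k k' assume k: "k \<in> R" "k' \<in> R" "p k = p k'"
      then have "same_action (g \<otimes> k) (g \<otimes> k')" using p[of k] p[of k'] by (auto simp: same_action_def)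
      then have "same_action (inv g \<otimes> (g \<otimes> k)) (inv g \<otimes> (g \<otimes> k'))"
        using same_action_mult_left R k g by (meson inv_closed m_closed subsetD)
      then have "same_action k k'" using R k g inv_mult_cancel by (metis subsetD)
      then show "k = k'" using R(2) k same by (meson inj_onD)
    qed
    then have "p ` R = R" using fin p by (intro endo_inj_surj) auto
    then have "(\<Sum>k\<in>R. F k) = (\<Sum>k\<in>R. F (p k))" using sum.reindex[OF inj, of F] by (simp add: comp_def)
    also have "\<dots> = (\<Sum>k\<in>R. F (g \<otimes> k))"
    proof (rule sum.cong[OF refl])
      fix k assume "k \<in> R"
      then show "F (p k) = F (g \<otimes> k)" using F[of "g \<otimes> k" "p k"] p[of k] R(1) g
        by (simp add: subset_iff)
    qed
    finally show ?thesis ..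
  qed
  ultimately show ?thesis using that fin R(1) by blast
qed

text \<open>This cancellation makes a coboundary a cocycle: \<open>u\<close> and \<open>r\<close>
  each meet their inverse.\<close>

lemma comm_group_telescope:
  assumes "p \<in> carrier A" "q \<in> carrier A" "r \<in> carrier A" "s \<in> carrier A" "t \<in> carrier A" "u \<in> carrier A"
  shows "p \<otimes>\<^bsub>A\<^esub> u \<otimes>\<^bsub>A\<^esub> inv\<^bsub>A\<^esub> t \<otimes>\<^bsub>A\<^esub> (q \<otimes>\<^bsub>A\<^esub> s \<otimes>\<^bsub>A\<^esub> inv\<^bsub>A\<^esub> u) =
    (p \<otimes>\<^bsub>A\<^esub> q \<otimes>\<^bsub>A\<^esub> inv\<^bsub>A\<^esub> r) \<otimes>\<^bsub>A\<^esub> (r \<otimes>\<^bsub>A\<^esub> s \<otimes>\<^bsub>A\<^esub> inv\<^bsub>A\<^esub> t)"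
proof -
  define r' t' u' where "r' = inv\<^bsub>A\<^esub> r" "t' = inv\<^bsub>A\<^esub> t" "u' = inv\<^bsub>A\<^esub> u"
  then have c: "r' \<in> carrier A" "t' \<in> carrier A" "u' \<in> carrier A" using assms by auto
  have "p \<otimes>\<^bsub>A\<^esub> u \<otimes>\<^bsub>A\<^esub> t' \<otimes>\<^bsub>A\<^esub> (q \<otimes>\<^bsub>A\<^esub> s \<otimes>\<^bsub>A\<^esub> u') = (p \<otimes>\<^bsub>A\<^esub> q \<otimes>\<^bsub>A\<^esub> s \<otimes>\<^bsub>A\<^esub> t') \<otimes>\<^bsub>A\<^esub> (u \<otimes>\<^bsub>A\<^esub> u')"
    "(p \<otimes>\<^bsub>A\<^esub> q \<otimes>\<^bsub>A\<^esub> r') \<otimes>\<^bsub>A\<^esub> (r \<otimes>\<^bsub>A\<^esub> s \<otimes>\<^bsub>A\<^esub> t') = (p \<otimes>\<^bsub>A\<^esub> q \<otimes>\<^bsub>A\<^esub> s \<otimes>\<^bsub>A\<^esub> t') \<otimes>\<^bsub>A\<^esub> (r \<otimes>\<^bsub>A\<^esub> r')"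
    using assms c by (simp_all add: A.m_ac)
  moreover have "u \<otimes>\<^bsub>A\<^esub> u' = \<one>\<^bsub>A\<^esub>" "r \<otimes>\<^bsub>A\<^esub> r' = \<one>\<^bsub>A\<^esub>" using assms by (simp_all add: r'_t'_u'_def)
  ultimately show ?thesis by (simp add: r'_t'_u'_def)
qed

lemma cocycle2_add_coboundary2:
  assumes f: "f \<in> carrier G \<rightarrow> carrier A"
  shows "cocycle2 G A act (\<lambda>g h. \<sigma> g h \<otimes>\<^bsub>A\<^esub> coboundary2 G A act f g h)"
proof -
  let ?\<beta> = "coboundary2 G A act f"
  have fc [simp]: "g \<in> carrier G \<Longrightarrow> f g \<in> carrier A" for g using f by auto
  have bc: "g \<in> carrier G \<Longrightarrow> h \<in> carrier G \<Longrightarrow> ?\<beta> g h \<in> carrier A" for g h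
    by (simp add: coboundary2_def)
  have b: "?\<beta> g (h \<otimes> k) \<otimes>\<^bsub>A\<^esub> ?\<beta> h k = act k (?\<beta> g h) \<otimes>\<^bsub>A\<^esub> ?\<beta> (g \<otimes> h) k"
    if "g \<in> carrier G" "h \<in> carrier G" "k \<in> carrier G" for g h k
    using comm_group_telescope[of "act (h \<otimes> k) (f g)" "act k (f h)" "act k (f (g \<otimes> h))" "f k" "f (g \<otimes> h \<otimes> k)" "f (h \<otimes> k)"] that
    by (simp add: coboundary2_def act_mult act_inv act_act m_assoc)
  show ?thesis
    unfolding cocycle2_def
  proof (intro conjI ballI)
    fix g h k assume c: "g \<in> carrier G" "h \<in> carrier G" "k \<in> carrier G"
    let ?s = "\<lambda>g h. \<sigma> g h \<otimes>\<^bsub>A\<^esub> ?\<beta> g h"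
    have "?s g (h \<otimes> k) \<otimes>\<^bsub>A\<^esub> ?s h k = (\<sigma> g (h \<otimes> k) \<otimes>\<^bsub>A\<^esub> \<sigma> h k) \<otimes>\<^bsub>A\<^esub> (?\<beta> g (h \<otimes> k) \<otimes>\<^bsub>A\<^esub> ?\<beta> h k)"
      using c bc by (simp add: A.m_ac)
    also have "\<dots> = act k (?s g h) \<otimes>\<^bsub>A\<^esub> ?s (g \<otimes> h) k"
      unfolding cocycle_eq[OF c] b[OF c] using c bc by (simp add: act_mult A.m_ac)
    finally show "?s g (h \<otimes> k) = act k (?s g h) \<otimes>\<^bsub>A\<^esub> ?s (g \<otimes> h) k \<otimes>\<^bsub>A\<^esub> inv\<^bsub>A\<^esub> (?s h k)"
      using c bc by (simp add: A.inv_solve_right)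
  qed (simp add: bc)
qed

lemma cohomologous2_add_coboundary2:
  assumes f: "f \<in> carrier G \<rightarrow> carrier A"
  shows "cohomologous2 G A act \<sigma> (\<lambda>g h. \<sigma> g h \<otimes>\<^bsub>A\<^esub> coboundary2 G A act f g h)"
  unfolding cohomologous2_def
proof (intro exI conjI ballI)
  have fc [simp]: "g \<in> carrier G \<Longrightarrow> f g \<in> carrier A" for g using f by auto
  show "(\<lambda>g. inv\<^bsub>A\<^esub> (f g)) \<in> carrier G \<rightarrow> carrier A" by simp
  fix g h assume c: "g \<in> carrier G" "h \<in> carrier G"
  have "coboundary2 G A act (\<lambda>g. inv\<^bsub>A\<^esub> (f g)) g h = inv\<^bsub>A\<^esub> (coboundary2 G A act f g h)"
    using c by (simp add: coboundary2_def act_inv A.inv_mult)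
  moreover have "coboundary2 G A act f g h \<in> carrier A" using c by (simp add: coboundary2_def)
  ultimately show "\<sigma> g h = \<sigma> g h \<otimes>\<^bsub>A\<^esub> coboundary2 G A act f g h \<otimes>\<^bsub>A\<^esub>
      coboundary2 G A act (\<lambda>g. inv\<^bsub>A\<^esub> (f g)) g h"
    using c by (simp add: A.m_assoc)
qed

end

section \<open>Bounding the cocycle\<close>

locale hyperbolic_cocycle = twisted_cocycle G A act \<sigma> + marked_group G S
  for G :: "('g, 'b) monoid_scheme" (structure) and A :: "('a, 'c) monoid_scheme" and act \<sigma> S +
  fixes \<delta> :: nat and I :: "'a set" and e :: "'a \<Rightarrow> 'a \<Rightarrow> int" and M :: int
  assumes hyperbolic: "hyperbolic_graph (carrier G) wdist \<delta>"
    and finite_basis: "finite I" and basis_closed: "I \<subseteq> carrier A" and M_pos: "M > 0"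
    and coordinate_hom: "\<And>i. i \<in> I \<Longrightarrow> e i \<in> hom A integer_group"
    and coordinate_expansion: "\<And>a. a \<in> carrier A \<Longrightarrow> a [^]\<^bsub>A\<^esub> M = A.int_comb I (\<lambda>i. e i a)"
    and finite_if_coordinates_finite:
      "\<And>Y. Y \<subseteq> carrier A \<Longrightarrow> (\<And>i. i \<in> I \<Longrightarrow> finite (e i ` Y)) \<Longrightarrow> finite Y"
begin

text \<open>\<open>k\<close> indexes the translates of the coordinate \<open>e i\<close>. It ranges
  over the whole group, but only its action matters, so finitely many functionals occur.\<close>

definition edge :: "'a \<Rightarrow> 'g \<Rightarrow> 'g \<Rightarrow> 'g \<Rightarrow> int" where
  "edge i k x y = e i (act k (simplex \<one> x y))"

lemma coordinate_act_mult:
  "i \<in> I \<Longrightarrow> k \<in> carrier G \<Longrightarrow> a \<in> carrier A \<Longrightarrow> b \<in> carrier A \<Longrightarrow>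
    e i (act k (a \<otimes>\<^bsub>A\<^esub> b)) = e i (act k a) + e i (act k b)"
  using A.hom_integer_mult[OF coordinate_hom] by (simp add: act_mult)

text \<open>The cocycle identity on \<one>, \<open>g\<close>, \<open>g \<otimes> x\<close>,
  \<open>g \<otimes> y\<close> exchanges the base vertices \<one> and \<open>g\<close> at the price
  of a difference of endpoint values; equivariance of \<open>simplex\<close> then turns
  \<open>k\<close> into \<open>inv g \<otimes> k\<close>.\<close>

lemma edge_translate:
  assumes "i \<in> I" "k \<in> carrier G" "g \<in> carrier G" "x \<in> carrier G" "y \<in> carrier G"
  shows "edge i k (g \<otimes> x) (g \<otimes> y) = edge i (inv g \<otimes> k) x y
    + e i (act k (simplex \<one> g (g \<otimes> y))) - e i (act k (simplex \<one> g (g \<otimes> x)))"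
proof -
  have "simplex \<one> g (g \<otimes> y) \<otimes>\<^bsub>A\<^esub> simplex g (g \<otimes> x) (g \<otimes> y) =
      simplex \<one> g (g \<otimes> x) \<otimes>\<^bsub>A\<^esub> simplex \<one> (g \<otimes> x) (g \<otimes> y)"
    using simplex_cocycle[of \<one> g "g \<otimes> x" "g \<otimes> y"] assms by simp
  from arg_cong[OF this, of "\<lambda>a. e i (act k a)"]
  have "e i (act k (simplex \<one> g (g \<otimes> y))) + e i (act k (simplex g (g \<otimes> x) (g \<otimes> y))) =
      e i (act k (simplex \<one> g (g \<otimes> x))) + edge i k (g \<otimes> x) (g \<otimes> y)"
    using assms by (simp add: coordinate_act_mult edge_def)
  moreover have "act k (simplex g (g \<otimes> x) (g \<otimes> y)) = act (inv g \<otimes> k) (simplex \<one> x y)"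
    using simplex_translate[of g \<one> x y] assms by (simp add: act_act)
  ultimately show ?thesis by (simp add: edge_def)
qed

section \<open>Uniform bounds for short loops\<close>

definition edge_weights :: "('g \<Rightarrow> 'g \<Rightarrow> int) set" where
  "edge_weights = (\<Union>i\<in>I. edge i ` carrier G)"

text \<open>The 0 makes the set nonempty and its maximum nonnegative.\<close>

definition ball_edge_values :: "nat \<Rightarrow> int set" where
  "ball_edge_values N = insert 0 (\<Union>i\<in>I. \<Union>x\<in>{g \<in> carrier G. wlen g \<le> N}. \<Union>y\<in>{g \<in> carrier G. wlen g \<le> N}.
     (\<lambda>k. \<bar>edge i k x y\<bar>) ` carrier G)"

definition loop_bound :: "nat \<Rightarrow> int" where
  "loop_bound N = int N * Max (ball_edge_values N)"

lemma finite_ball_edge_values: "finite (ball_edge_values N)"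
proof -
  have "finite ((\<lambda>k. \<bar>edge i k x y\<bar>) ` carrier G)" if "x \<in> carrier G" "y \<in> carrier G" for i x y
  proof -
    have "(\<lambda>k. \<bar>edge i k x y\<bar>) ` carrier G = (\<lambda>a. \<bar>e i a\<bar>) ` (\<lambda>k. act k (simplex \<one> x y)) ` carrier G"
      by (simp add: image_image edge_def)
    then show ?thesis using finite_orbit that by simp
  qed
  then show ?thesis unfolding ball_edge_values_def
    using finite_basis finite_ball by (intro finite.insertI finite_UN_I) auto
qed

end

sublocale hyperbolic_cocycle \<subseteq> graph: hyperbolic_graph "carrier G" wdist \<delta>
  by (rule hyperbolic)

context hyperbolic_cocycle
begin

lemma identity_loop_weight_bound:
  assumes i: "i \<in> I" and k: "k \<in> carrier G" and s: "graph.weighted_walk (edge i k) \<one> \<one> n s" and n: "n \<le> N"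
  shows "\<bar>s\<bar> \<le> loop_bound N"
proof -
  obtain w where w: "graph.walk n w" "w 0 = \<one>" "w n = \<one>" "s = (\<Sum>j<n. edge i k (w j) (w (Suc j)))"
    using s by (auto simp: graph.weighted_walk_def)
  let ?m = "Max (ball_edge_values N)"
  have m: "v \<in> ball_edge_values N \<Longrightarrow> v \<le> ?m" for v using finite_ball_edge_values by simp
  have ball: "w j \<in> {g \<in> carrier G. wlen g \<le> N}" if "j \<le> n" for j
    using graph.walk_D_le[OF w(1), of 0 j] w n that by (auto simp: graph.walk_def wdist_def)
  have "\<bar>s\<bar> \<le> (\<Sum>j<n. \<bar>edge i k (w j) (w (Suc j))\<bar>)" unfolding w(4) by (rule sum_abs)
  also have "\<dots> \<le> (\<Sum>j<n. ?m)"
  proof (rule sum_mono)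
    fix j assume "j \<in> {..<n}"
    then have "w j \<in> {g \<in> carrier G. wlen g \<le> N}" "w (Suc j) \<in> {g \<in> carrier G. wlen g \<le> N}"
      using ball by auto
    then show "\<bar>edge i k (w j) (w (Suc j))\<bar> \<le> ?m"
      using i k by (intro m) (auto simp: ball_edge_values_def)
  qed
  also have "\<dots> = int n * ?m" by simp
  also have "\<dots> \<le> loop_bound N"
    unfolding loop_bound_def using m[of 0] n by (intro mult_right_mono) (auto simp: ball_edge_values_def)
  finally show ?thesis by simp
qed

text \<open>Translation by \<open>inv x\<close> moves the loop to the identity, where it stays in a
  finite ball. The correction \<open>h\<close> cancels on a closed walk, and the bound there holds
  for every \<open>k\<close>, in particular for \<open>inv x \<otimes> k\<close>.\<close>

lemma edge_loop_weight_bound: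
  assumes b: "b \<in> edge_weights" and s: "graph.weighted_walk b x x n s" and n: "n \<le> N"
  shows "\<bar>s\<bar> \<le> loop_bound N"
proof -
  obtain i k where ik: "i \<in> I" "k \<in> carrier G" "b = edge i k" using b by (auto simp: edge_weights_def)
  have x: "x \<in> carrier G" using graph.weighted_walk_in_V s by blast
  define h where "h z = - e i (act k (simplex \<one> x z))" for z
  have "graph.weighted_walk (edge i (inv x \<otimes> k)) (inv x \<otimes> x) (inv x \<otimes> x) n (s + h x - h x)"
  proof (rule graph.weighted_walk_transport[where T = "\<lambda>z. inv x \<otimes> z" and h = h, OF _ _ _ s])
    fix y z assume yz: "y \<in> carrier G" "z \<in> carrier G"
    then show "wdist (inv x \<otimes> y) (inv x \<otimes> z) = wdist y z" using x by (simp add: wdist_left_mult)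
    show "edge i (inv x \<otimes> k) (inv x \<otimes> y) (inv x \<otimes> z) = b y z + h z - h y"
      using edge_translate[of i k x "inv x \<otimes> y" "inv x \<otimes> z"] ik x yz by (simp add: h_def mult_inv_cancel)
  qed (use x in simp)
  then have "graph.weighted_walk (edge i (inv x \<otimes> k)) \<one> \<one> n s" using x by simp
  then show ?thesis by (rule identity_loop_weight_bound[rotated 2]) (use ik x n in auto)
qed

end

sublocale hyperbolic_cocycle \<subseteq> weighted: weighted_hyperbolic_graph "carrier G" wdist \<delta> edge_weights loop_bound
  by unfold_locales (rule edge_loop_weight_bound)

context hyperbolic_cocycle
begin

section \<open>Potentials and their coboundary\<close>

abbreviation potential :: "'a \<Rightarrow> 'g \<Rightarrow> 'g \<Rightarrow> 'g \<Rightarrow> int" where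
  "potential i k \<equiv> weighted.skew_peak (edge i k)"

lemma edge_in_weights: "i \<in> I \<Longrightarrow> k \<in> carrier G \<Longrightarrow> edge i k \<in> edge_weights"
  by (auto simp: edge_weights_def)

text \<open>The endpoint terms enter the two directions of \<open>peak\<close> with opposite signs,
  hence the factor 2.\<close>

lemma potential_translate:
  assumes "i \<in> I" "k \<in> carrier G" "g \<in> carrier G" "x \<in> carrier G" "y \<in> carrier G"
  shows "potential i k (g \<otimes> x) (g \<otimes> y) = potential i (inv g \<otimes> k) x y
    + 2 * (e i (act k (simplex \<one> g (g \<otimes> y))) - e i (act k (simplex \<one> g (g \<otimes> x))))"
proof -
  have "weighted.peak (edge i k) (g \<otimes> u) (g \<otimes> v) = weighted.peak (edge i (inv g \<otimes> k)) u v
     + e i (act k (simplex \<one> g (g \<otimes> v))) - e i (act k (simplex \<one> g (g \<otimes> u)))"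
    if "u \<in> carrier G" "v \<in> carrier G" for u v
    by (rule weighted.peak_transport[where T = "\<lambda>z. g \<otimes> z" and T' = "\<lambda>z. inv g \<otimes> z"
          and h = "\<lambda>z. e i (act k (simplex \<one> g (g \<otimes> z)))"])
      (use assms that in \<open>simp_all add: edge_in_weights wdist_left_mult inv_mult_cancel mult_inv_cancel edge_translate\<close>)
  then show ?thesis using assms by (simp add: weighted.skew_peak_def)
qed

lemma potential_same_action:
  assumes "i \<in> I" "k \<in> carrier G" "k' \<in> carrier G" "same_action k k'" "x \<in> carrier G" "y \<in> carrier G"
  shows "potential i k x y = potential i k' x y"
proof -
  have "weighted.peak (edge i k) u v = weighted.peak (edge i k') u v + 0 - 0"
    if "u \<in> carrier G" "v \<in> carrier G" for u v
    by (rule weighted.peak_transport[where T = "\<lambda>z. z" and T' = "\<lambda>z. z" and h = "\<lambda>z. 0"])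
      (use assms that in \<open>simp_all add: edge_in_weights edge_def same_action_def\<close>)
  then show ?thesis using assms by (simp add: weighted.skew_peak_def)
qed

text \<open>In the triangle \<one>, \<open>g\<close>, \<open>g \<otimes> h\<close>, translating the
  side from \<open>g\<close> to \<open>g \<otimes> h\<close> back to the identity produces the
  cocycle value, plus a degenerate simplex with finitely many values. Up to bounded error, half of
  \<open>potential\<close> thus has minus the coordinate of the cocycle as its coboundary.\<close>

lemma potential_almost_trivialises:
  "\<exists>C. \<forall>i\<in>I. \<forall>k\<in>carrier G. \<forall>g\<in>carrier G. \<forall>h\<in>carrier G.
     \<bar>potential i k \<one> g + potential i (inv g \<otimes> k) \<one> h - potential i k \<one> (g \<otimes> h)
       + 2 * e i (act k (simplex \<one> g (g \<otimes> h)))\<bar> \<le> C"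
proof -
  obtain C where C: "\<forall>b\<in>edge_weights. \<forall>x\<in>carrier G. \<forall>y\<in>carrier G. \<forall>z\<in>carrier G.
      \<bar>weighted.skew_peak b x y + weighted.skew_peak b y z + weighted.skew_peak b z x\<bar> \<le> C"
    using weighted.skew_peak_bounded_coboundary by blast
  define Y where "Y = (\<Union>i\<in>I. (\<lambda>a. \<bar>e i a\<bar>) ` (\<lambda>k. act k (\<sigma> \<one> \<one>)) ` carrier G)"
  have Y: "finite Y" unfolding Y_def using finite_basis finite_orbit by auto
  show ?thesis
  proof (rule exI[of _ "C + 2 * Max Y"], intro ballI)
    fix i k g h assume c: "i \<in> I" "k \<in> carrier G" "g \<in> carrier G" "h \<in> carrier G"
    have deg: "act k (simplex \<one> g g) = act (inv g \<otimes> k) (\<sigma> \<one> \<one>)"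
      using c by (simp add: simplex_degenerate act_act)
    have "\<bar>e i (act k (simplex \<one> g g))\<bar> \<in> Y"
      unfolding Y_def deg image_image by (rule UN_I[OF c(1)], rule imageI) (use c in simp)
    then have "\<bar>e i (act k (simplex \<one> g g))\<bar> \<le> Max Y" using Y by simp
    moreover have "potential i k g (g \<otimes> h) = potential i (inv g \<otimes> k) \<one> h
      + 2 * (e i (act k (simplex \<one> g (g \<otimes> h))) - e i (act k (simplex \<one> g g)))"
      using potential_translate[of i k g \<one> h] c by simp
    moreover have "potential i k (g \<otimes> h) \<one> = - potential i k \<one> (g \<otimes> h)"
      by (simp add: weighted.skew_peak_def)
    moreover have "\<bar>potential i k \<one> g + potential i k g (g \<otimes> h) + potential i k (g \<otimes> h) \<one>\<bar> \<le> C"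
      using C edge_in_weights c by auto
    ultimately show "\<bar>potential i k \<one> g + potential i (inv g \<otimes> k) \<one> h - potential i k \<one> (g \<otimes> h)
       + 2 * e i (act k (simplex \<one> g (g \<otimes> h)))\<bar> \<le> C + 2 * Max Y" by (smt (verit))
  qed
qed

text \<open>Expand the \<open>M\<close>-th power of \<open>act k a\<close> in \<open>I\<close> and
  apply \<psi> after \<open>act (inv k)\<close>. Since every \<open>k\<close> gives the same left
  side, the identity can be summed over \<open>R\<close>.\<close>

lemma coordinate_reconstruction:
  assumes "\<psi> \<in> hom A integer_group" "a \<in> carrier A" "k \<in> carrier G"
  shows "M * \<psi> a = (\<Sum>i\<in>I. e i (act k a) * \<psi> (act (inv k) i))"
proof -
  let ?\<psi> = "\<lambda>a. \<psi> (act (inv k) a)"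
  have hom: "?\<psi> \<in> hom A integer_group" by (rule hom_comp_act) (use assms in auto)
  have "M * \<psi> a = M * ?\<psi> (act k a)" using assms by (simp add: act_act)
  also have "\<dots> = ?\<psi> (act k a [^]\<^bsub>A\<^esub> M)" using A.hom_integer_pow[OF hom] assms by simp
  also have "act k a [^]\<^bsub>A\<^esub> M = A.int_comb I (\<lambda>i. e i (act k a))"
    by (rule coordinate_expansion) (use assms in simp)
  also have "?\<psi> \<dots> = (\<Sum>i\<in>I. e i (act k a) * ?\<psi> i)"
    by (rule A.hom_integer_int_comb[OF hom finite_basis basis_closed])
  finally show ?thesis .
qed

text \<open>Averaging the rounded potentials over representatives of the finite image of \<open>G\<close> makes them equivariant.
  Division by \<open>2 * M * card R\<close> accounts for \<open>skew_peak\<close> being twice the real potential, for the torsion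
  exponent \<open>M\<close>, and for the number of terms in the average.\<close>

theorem bounded_representative:
  "\<exists>f\<in>carrier G \<rightarrow> carrier A.
     finite ((\<lambda>(g, h). \<sigma> g h \<otimes>\<^bsub>A\<^esub> coboundary2 G A act f g h) ` (carrier G \<times> carrier G))"
proof -
  obtain R where R: "finite R" "R \<subseteq> carrier G" "R \<noteq> {}"
    and reindex: "\<And>F g. (\<And>k k'. k \<in> carrier G \<Longrightarrow> k' \<in> carrier G \<Longrightarrow> same_action k k' \<Longrightarrow> F k = F k') \<Longrightarrow>
       g \<in> carrier G \<Longrightarrow> (\<Sum>k\<in>R. F (g \<otimes> k)) = (\<Sum>k\<in>R. F k :: int)"
    using action_representatives by metis
  obtain C where C: "\<And>i k g h. i \<in> I \<Longrightarrow> k \<in> carrier G \<Longrightarrow> g \<in> carrier G \<Longrightarrow> h \<in> carrier G \<Longrightarrow>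
     \<bar>potential i k \<one> g + potential i (inv g \<otimes> k) \<one> h - potential i k \<one> (g \<otimes> h)
       + 2 * e i (act k (simplex \<one> g (g \<otimes> h)))\<bar> \<le> C"
    using potential_almost_trivialises by metis
  define N where "N = 2 * M * int (card R)"
  have N: "N > 0" using M_pos R by (simp add: N_def card_gt_0_iff)
  \<comment> \<open>Coefficients in \<open>A\<close> must be integers; integer division brings an
    error of at most \<open>N\<close> after multiplying back.\<close>
  define r where "r i k g = potential i k \<one> g div N" for i k g
  have r: "\<bar>N * r i k g - potential i k \<one> g\<bar> \<le> N" for i k g
    using N mult_div_mod_eq[of N "potential i k \<one> g"] pos_mod_bound[OF N] pos_mod_sign[OF N]
    unfolding r_def by (smt (verit))
  \<comment> \<open>The rounded potentials of \<open>e i\<close> after \<open>act k\<close> become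
    coefficients on \<open>I\<close>, carried back by \<open>act (inv k)\<close> as in
    \<open>coordinate_reconstruction\<close>.\<close>
  define F where "F g = finprod A (\<lambda>k. act (inv k) (A.int_comb I (\<lambda>i. r i k g))) R" for g
  have Fc [simp]: "F g \<in> carrier A" for g
    unfolding F_def using R basis_closed by (intro A.finprod_closed) auto
  have \<psi>F: "\<psi> (F g) = (\<Sum>k\<in>R. \<Sum>i\<in>I. r i k g * \<psi> (act (inv k) i))" if "\<psi> \<in> hom A integer_group" for \<psi> g
  proof -
    have "\<psi> (F g) = (\<Sum>k\<in>R. \<psi> (act (inv k) (A.int_comb I (\<lambda>i. r i k g))))"
      unfolding F_def by (rule A.hom_integer_finprod[OF that R(1)]) (use R basis_closed in auto)
    also have "\<dots> = (\<Sum>k\<in>R. \<Sum>i\<in>I. r i k g * \<psi> (act (inv k) i))"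
      by (intro sum.cong refl A.hom_integer_int_comb hom_comp_act that finite_basis basis_closed)
        (use R in auto)
    finally show ?thesis .
  qed
  \<comment> \<open>Reindexing the average from \<open>k\<close> to \<open>g \<otimes> k\<close>
    restores \<open>act (inv k) i\<close> and leaves coefficients at
    \<open>inv g \<otimes> k\<close>, which match the middle term of
    \<open>potential_almost_trivialises\<close>.\<close>
  have \<psi>F_act: "\<psi> (act (inv g) (F h)) = (\<Sum>k\<in>R. \<Sum>i\<in>I. r i (inv g \<otimes> k) h * \<psi> (act (inv k) i))"
    if \<psi>: "\<psi> \<in> hom A integer_group" and gh: "g \<in> carrier G" "h \<in> carrier G" for \<psi> g h
  proof -
    define \<Phi> where "\<Phi> k = (\<Sum>i\<in>I. r i (inv g \<otimes> k) h * \<psi> (act (inv k) i))" for k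
    have "\<psi> (act (inv g) (F h)) = (\<Sum>k\<in>R. \<Sum>i\<in>I. r i k h * \<psi> (act (inv g) (act (inv k) i)))"
      using \<psi>F[OF hom_comp_act[OF \<psi>, of "inv g"]] gh by simp
    also have "\<dots> = (\<Sum>k\<in>R. \<Phi> (g \<otimes> k))"
      unfolding \<Phi>_def
      by (intro sum.cong refl) (use R gh basis_closed in \<open>simp add: act_act inv_mult_group inv_mult_cancel subset_iff\<close>)
    also have "\<dots> = (\<Sum>k\<in>R. \<Phi> k)"
    proof (rule reindex[OF _ gh(1)])
      fix k k' assume k: "k \<in> carrier G" "k' \<in> carrier G" "same_action k k'"
      have "r i (inv g \<otimes> k) h = r i (inv g \<otimes> k') h" if "i \<in> I" for i
        unfolding r_def using k gh that same_action_mult_left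
          potential_same_action[of i "inv g \<otimes> k" "inv g \<otimes> k'" \<one> h] by simp
      moreover have "act (inv k) i = act (inv k') i" if "i \<in> I" for i
        using same_action_inv k that basis_closed by (auto simp: same_action_def)
      ultimately show "\<Phi> k = \<Phi> k'" unfolding \<Phi>_def by (intro sum.cong) auto
    qed
    finally show ?thesis by (simp add: \<Phi>_def)
  qed
  \<comment> \<open>The homogeneous form of the corrected cocycle on \<one>, \<open>g\<close>,
    \<open>g \<otimes> h\<close>.\<close>
  define T where "T g h = F g \<otimes>\<^bsub>A\<^esub> act (inv g) (F h) \<otimes>\<^bsub>A\<^esub> inv\<^bsub>A\<^esub> (F (g \<otimes> h)) \<otimes>\<^bsub>A\<^esub> simplex \<one> g (g \<otimes> h)" for g h
  have Tc: "g \<in> carrier G \<Longrightarrow> h \<in> carrier G \<Longrightarrow> T g h \<in> carrier A" for g h by (simp add: T_def)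
  define TT where "TT = (\<lambda>(g, h). T g h) ` (carrier G \<times> carrier G)"
  have "finite TT"
  proof (rule finite_if_coordinates_finite)
    show "TT \<subseteq> carrier A" using Tc by (auto simp: TT_def)
    fix j assume "j \<in> I"
    define \<psi> where "\<psi> = e j"
    have \<psi>: "\<psi> \<in> hom A integer_group" unfolding \<psi>_def by (rule coordinate_hom) fact
    \<comment> \<open>\<open>C\<close> bounds the error of the exact potentials; three roundings add
      at most \<open>N\<close> each.\<close>
    define E where "E = (\<Sum>k\<in>R. \<Sum>i\<in>I. (C + 3 * N) * \<bar>\<psi> (act (inv k) i)\<bar>)"
    have "\<bar>\<psi> (T g h)\<bar> \<le> E" if gh: "g \<in> carrier G" "h \<in> carrier G" for g h
    proof -
      let ?c = "simplex \<one> g (g \<otimes> h)"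
      define t where "t k i = N * r i k g + N * r i (inv g \<otimes> k) h - N * r i k (g \<otimes> h) + 2 * e i (act k ?c)" for k i
      have cc: "?c \<in> carrier A" using gh by simp
      have "N * \<psi> ?c = (\<Sum>k\<in>R. 2 * (M * \<psi> ?c))" by (simp add: N_def)
      also have "\<dots> = (\<Sum>k\<in>R. \<Sum>i\<in>I. 2 * e i (act k ?c) * \<psi> (act (inv k) i))"
      proof (rule sum.cong[OF refl])
        fix k assume "k \<in> R"
        then have "k \<in> carrier G" using R by auto
        from coordinate_reconstruction[OF \<psi> cc this]
        show "2 * (M * \<psi> ?c) = (\<Sum>i\<in>I. 2 * e i (act k ?c) * \<psi> (act (inv k) i))"
          by (simp add: sum_distrib_left mult.assoc)
      qed
      finally have c: "N * \<psi> ?c = (\<Sum>k\<in>R. \<Sum>i\<in>I. 2 * e i (act k ?c) * \<psi> (act (inv k) i))" .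
      have "\<psi> (T g h) = \<psi> (F g) + \<psi> (act (inv g) (F h)) - \<psi> (F (g \<otimes> h)) + \<psi> ?c"
        unfolding T_def using gh by (simp add: A.hom_integer_mult[OF \<psi>] A.hom_integer_inv[OF \<psi>])
      then have "N * \<psi> (T g h) = N * \<psi> (F g) + N * \<psi> (act (inv g) (F h)) - N * \<psi> (F (g \<otimes> h)) + N * \<psi> ?c"
        by (simp only: distrib_left right_diff_distrib)
      also have "\<dots> = (\<Sum>k\<in>R. \<Sum>i\<in>I. t k i * \<psi> (act (inv k) i))"
        unfolding c \<psi>F[OF \<psi>] \<psi>F_act[OF \<psi> gh] t_def
        by (simp add: sum_distrib_left sum.distrib sum_subtractf left_diff_distrib distrib_right mult.assoc)
      finally have "\<bar>N * \<psi> (T g h)\<bar> \<le> (\<Sum>k\<in>R. \<bar>\<Sum>i\<in>I. t k i * \<psi> (act (inv k) i)\<bar>)" by simp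
      also have "\<dots> \<le> (\<Sum>k\<in>R. \<Sum>i\<in>I. \<bar>t k i * \<psi> (act (inv k) i)\<bar>)" by (intro sum_mono sum_abs)
      also have "\<dots> \<le> E"
        unfolding E_def
      proof (intro sum_mono)
        fix k i assume ki: "k \<in> R" "i \<in> I"
        then have "k \<in> carrier G" using R by auto
        then have "\<bar>t k i\<bar> \<le> C + 3 * N"
          using C[OF ki(2) _ gh, of k] r[of i k g] r[of i "inv g \<otimes> k" h] r[of i k "g \<otimes> h"]
          unfolding t_def by (smt (verit))
        then show "\<bar>t k i * \<psi> (act (inv k) i)\<bar> \<le> (C + 3 * N) * \<bar>\<psi> (act (inv k) i)\<bar>"
          by (simp add: abs_mult mult_right_mono)
      qed
      finally have "N * \<bar>\<psi> (T g h)\<bar> \<le> E" using N by (simp add: abs_mult)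
      moreover have "1 * \<bar>\<psi> (T g h)\<bar> \<le> N * \<bar>\<psi> (T g h)\<bar>" using N by (intro mult_right_mono) auto
      ultimately show ?thesis by linarith
    qed
    then have "\<psi> ` TT \<subseteq> {-E..E}" unfolding TT_def abs_le_iff by (fastforce simp: minus_le_iff)
    then show "finite (e j ` TT)" unfolding \<psi>_def by (rule finite_subset) simp
  qed
  \<comment> \<open>The corrected cocycle is \<open>act (g \<otimes> h)\<close> applied to
    \<open>T g h\<close>, so its values lie in finitely many finite orbits.\<close>
  then have fin: "finite (\<Union>a\<in>TT. (\<lambda>k. act k a) ` carrier G)"
    using finite_orbit Tc by (intro finite_UN_I) (auto simp: TT_def)
  \<comment> \<open>\<open>act g\<close> converts \<open>F\<close>, which is adapted to the left
    action by inverses, to the right action of \<open>coboundary2\<close>.\<close>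
  define f where "f g = act g (F g)" for g
  have "\<sigma> g h \<otimes>\<^bsub>A\<^esub> coboundary2 G A act f g h = act (g \<otimes> h) (T g h)"
    if gh: "g \<in> carrier G" "h \<in> carrier G" for g h
  proof -
    have "simplex \<one> g (g \<otimes> h) = act (inv (g \<otimes> h)) (\<sigma> g h)"
      using gh by (simp add: simplex_def inv_mult_cancel)
    then have "act (g \<otimes> h) (simplex \<one> g (g \<otimes> h)) = \<sigma> g h" using gh by (simp add: act_act)
    moreover have "act (g \<otimes> h) (act (inv g) (F h)) = f h"
      using gh by (simp add: f_def act_act inv_mult_cancel)
    moreover have "act (g \<otimes> h) (F g) = act h (f g)" using gh by (simp add: f_def act_act)
    ultimately show ?thesis
      unfolding T_def coboundary2_def using gh
      by (simp add: act_mult act_inv A.m_comm f_def)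
  qed
  then have "(\<lambda>(g, h). \<sigma> g h \<otimes>\<^bsub>A\<^esub> coboundary2 G A act f g h) ` (carrier G \<times> carrier G)
      \<subseteq> (\<Union>a\<in>TT. (\<lambda>k. act k a) ` carrier G)"
    unfolding TT_def by fastforce
  then have "finite ((\<lambda>(g, h). \<sigma> g h \<otimes>\<^bsub>A\<^esub> coboundary2 G A act f g h) ` (carrier G \<times> carrier G))"
    using fin by (rule finite_subset)
  moreover have "f \<in> carrier G \<rightarrow> carrier A" by (simp add: f_def)
  ultimately show ?thesis by blast
qed

end

theorem theorem3p1:
  fixes G :: "('g, 'b) monoid_scheme" and A :: "('a, 'c) monoid_scheme"
    and act :: "'g \<Rightarrow> 'a \<Rightarrow> 'a"
  assumes "hyperbolic_group G"
    and "fg_abelian_group A"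
    and "right_action_by_auts G A act"
    and "finite (action_image G A act)"
    and "cocycle2 G A act \<sigma>"
  shows "\<exists>\<tau>. cocycle2 G A act \<tau> \<and> cohomologous2 G A act \<sigma> \<tau> \<and>
             finite ((\<lambda>(g, h). \<tau> g h) ` (carrier G \<times> carrier G))"
proof -
  obtain S \<delta> where G: "group G" and S: "finite S" "S \<subseteq> carrier G" "generate G S = carrier G"
    and hyp: "\<forall>w\<in>carrier G. \<forall>x\<in>carrier G. \<forall>y\<in>carrier G. \<forall>z\<in>carrier G.
           gromov_product G S w x y \<ge>
             min (gromov_product G S w x z) (gromov_product G S w y z) - \<delta>"
    using assms(1) unfolding hyperbolic_group_def by auto
  obtain B where A: "comm_group A" and B: "finite B" "B \<subseteq> carrier A" "generate A B = carrier A"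
    using assms(2) unfolding fg_abelian_group_def by auto
  interpret G: marked_group G S using G S by (simp add: marked_group_def marked_group_axioms_def)
  interpret A: comm_group A by (rule A)
  interpret cocycle: twisted_cocycle G A act \<sigma>
    by unfold_locales (use assms in auto)
  interpret graph: hyperbolic_graph "carrier G" G.wdist "nat \<lceil>2 * \<delta>\<rceil>"
    by (rule G.hyperbolic_graph_word_metric) (use hyp in auto)
  obtain I and M :: int and e where I: "finite I" "I \<subseteq> carrier A" "M > 0"
    "\<And>i. i \<in> I \<Longrightarrow> e i \<in> hom A integer_group"
    "\<And>a. a \<in> carrier A \<Longrightarrow> a [^]\<^bsub>A\<^esub> M = A.int_comb I (\<lambda>i. e i a)"
    "\<And>Y. Y \<subseteq> carrier A \<Longrightarrow> (\<And>i. i \<in> I \<Longrightarrow> finite (e i ` Y)) \<Longrightarrow> finite Y"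
    using A.finitely_generated_coordinates[OF B] by metis
  interpret hyperbolic_cocycle G A act \<sigma> S "nat \<lceil>2 * \<delta>\<rceil>" I e M
    by unfold_locales (fact I)+
  obtain f where f: "f \<in> carrier G \<rightarrow> carrier A"
    "finite ((\<lambda>(g, h). \<sigma> g h \<otimes>\<^bsub>A\<^esub> coboundary2 G A act f g h) ` (carrier G \<times> carrier G))"
    using bounded_representative by blast
  show ?thesis
    using cocycle.cocycle2_add_coboundary2[OF f(1)] cocycle.cohomologous2_add_coboundary2[OF f(1)] f(2)
    by blast
qed

end
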